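(* (One-round point-to-point.) The set of triples $(R_0,R_X,R_Y)$ in the rate region of the function computation problem with $R_Y>R_0+H(Y)$ equals the set of nonnegative triples with $R_Y>R_0+H(Y)$ and $R_0+R_X\ge H(G_{X|Y})$.
   Context: Setup: $\mathcal X,\mathcal Y,\mathcal F$ finite, $(X_i,Y_i)_{i\ge1}$ i.i.d. copies of $(X,Y)\sim p(x,y)$, $f:\mathcal X\times\mathcal Y\to\mathcal F$ applied componentwise to sequences. An $(n,R_0,R_X,R_Y)$ code consists of encoders $\varphi_0:\mathcal X^n\to\{1,\dots,2^{nR_0}\}$, $\varphi_X:\mathcal X^n\to\{1,\dots,2^{nR_X}\}$, $\varphi_Y:\mathcal Y^n\times\{1,\dots,2^{nR_0}\}\to\{1,\dots,2^{nR_Y}\}$ and a decoder $\psi:\{1,\dots,2^{nR_X}\}\times\{1,\dots,2^{nR_Y}\}\to\mathcal F^n$, with error probability $P(\psi(\varphi_X(\mathbf X),\varphi_Y(\varphi_0(\mathbf X),\mathbf Y))\ne f(\mathbf X,\mathbf Y))$. A triple is achievable if for every $\varepsilon>0$ and all large $n$ a code with error probability $\le\varepsilon$ exists; the rate region is the closure of the achievable set. $G_{X|Y}$ is the graph with vertex set $\mathcal X$ in which $x_1,x_2$ are adjacent iff there is $y$ with $p(x_1,y)p(x_2,y)>0$ and $f(x_1,y)\ne f(x_2,y)$. The conditional graph entropy is $H(G_{X|Y})=\min I(V;X|Y)$, the minimum over random variables $V$ with $V-X-Y$ Markov, each value of $V$ being an independent set of $G_{X|Y}$, and $P(X\in V)=1$.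 *)

theory Defs
  imports "HOL-Probability.Probability"
begin

definition seqs :: "nat \<Rightarrow> (nat \<Rightarrow> 'a) set" where
  "seqs n = ({..<n} \<rightarrow>\<^sub>E (UNIV :: 'a set))"

definition msgs :: "nat \<Rightarrow> real \<Rightarrow> nat" where
  "msgs n R = nat \<lfloor>2 powr (real n * R)\<rfloor>"

definition seq_prob :: "('x \<times> 'y) pmf \<Rightarrow> nat \<Rightarrow> (nat \<Rightarrow> 'x) \<Rightarrow> (nat \<Rightarrow> 'y) \<Rightarrow> real" where
  "seq_prob p n xs ys = (\<Prod>i<n. pmf p (xs i, ys i))"

definition err_prob ::
  "('x::finite \<times> 'y::finite) pmf \<Rightarrow> ('x \<Rightarrow> 'y \<Rightarrow> 'f) \<Rightarrow> nat \<Rightarrow>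
   ((nat \<Rightarrow> 'x) \<Rightarrow> nat) \<Rightarrow> ((nat \<Rightarrow> 'x) \<Rightarrow> nat) \<Rightarrow> ((nat \<Rightarrow> 'y) \<Rightarrow> nat \<Rightarrow> nat) \<Rightarrow>
   (nat \<Rightarrow> nat \<Rightarrow> (nat \<Rightarrow> 'f)) \<Rightarrow> real" where
  "err_prob p f n \<phi>0 \<phi>X \<phi>Y \<psi> =
     (\<Sum>(xs, ys) \<in> seqs n \<times> seqs n.
        seq_prob p n xs ys *
        (if (\<exists>i<n. \<psi> (\<phi>X xs) (\<phi>Y ys (\<phi>0 xs)) i \<noteq> f (xs i) (ys i)) then 1 else 0))"

definition good_code ::
  "('x::finite \<times> 'y::finite) pmf \<Rightarrow> ('x \<Rightarrow> 'y \<Rightarrow> 'f) \<Rightarrow> nat \<Rightarrow> real \<Rightarrow> real \<Rightarrow> real \<Rightarrow> real \<Rightarrow> bool" where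
  "good_code p f n R0 RX RY \<epsilon> \<longleftrightarrow>
     (\<exists>(\<phi>0 :: (nat \<Rightarrow> 'x) \<Rightarrow> nat) (\<phi>X :: (nat \<Rightarrow> 'x) \<Rightarrow> nat)
        (\<phi>Y :: (nat \<Rightarrow> 'y) \<Rightarrow> nat \<Rightarrow> nat) (\<psi> :: nat \<Rightarrow> nat \<Rightarrow> (nat \<Rightarrow> 'f)).
        (\<forall>xs \<in> seqs n. \<phi>0 xs \<in> {1..msgs n R0} \<and> \<phi>X xs \<in> {1..msgs n RX}) \<and>
        (\<forall>ys \<in> seqs n. \<forall>m \<in> {1..msgs n R0}. \<phi>Y ys m \<in> {1..msgs n RY}) \<and>
        err_prob p f n \<phi>0 \<phi>X \<phi>Y \<psi> \<le> \<epsilon>)"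

definition achievable ::
  "('x::finite \<times> 'y::finite) pmf \<Rightarrow> ('x \<Rightarrow> 'y \<Rightarrow> 'f) \<Rightarrow> real \<times> real \<times> real \<Rightarrow> bool" where
  "achievable p f r \<longleftrightarrow>
     (case r of (R0, RX, RY) \<Rightarrow>
        (\<forall>\<epsilon>>0. \<exists>N. \<forall>n\<ge>N. good_code p f n R0 RX RY \<epsilon>))"

definition rate_region ::
  "('x::finite \<times> 'y::finite) pmf \<Rightarrow> ('x \<Rightarrow> 'y \<Rightarrow> 'f) \<Rightarrow> (real \<times> real \<times> real) set" where
  "rate_region p f = closure {r. achievable p f r}"

definition entropy_pmf :: "'a::finite pmf \<Rightarrow> real" where
  "entropy_pmf q = - (\<Sum>a\<in>UNIV. if pmf q a > 0 then pmf q a * log 2 (pmf q a) else 0)"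

definition char_adj :: "('x \<times> 'y) pmf \<Rightarrow> ('x \<Rightarrow> 'y \<Rightarrow> 'f) \<Rightarrow> 'x \<Rightarrow> 'x \<Rightarrow> bool" where
  "char_adj p f x1 x2 \<longleftrightarrow>
     (\<exists>y. pmf p (x1, y) * pmf p (x2, y) > 0 \<and> f x1 y \<noteq> f x2 y)"

definition indep_set :: "('x \<times> 'y) pmf \<Rightarrow> ('x \<Rightarrow> 'y \<Rightarrow> 'f) \<Rightarrow> 'x set \<Rightarrow> bool" where
  "indep_set p f S \<longleftrightarrow> (\<forall>x1\<in>S. \<forall>x2\<in>S. \<not> char_adj p f x1 x2)"

text \<open>A random variable V with V - X - Y Markov is given by its conditional
  distribution Q x = P(V = . | X = x); joint law P(v,x,y) = p(x,y) Q(x)(v).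
  Its values are sets of vertices.\<close>
definition admissible_V ::
  "('x \<times> 'y) pmf \<Rightarrow> ('x \<Rightarrow> 'y \<Rightarrow> 'f) \<Rightarrow> ('x \<Rightarrow> 'x set pmf) \<Rightarrow> bool" where
  "admissible_V p f Q \<longleftrightarrow>
     (\<forall>x v. pmf (map_pmf fst p) x * pmf (Q x) v > 0 \<longrightarrow> indep_set p f v \<and> x \<in> v)"

definition cond_mutual_info ::
  "('x::finite \<times> 'y::finite) pmf \<Rightarrow> ('x \<Rightarrow> 'x set pmf) \<Rightarrow> real" where
  "cond_mutual_info p Q =
     (\<Sum>v\<in>UNIV. \<Sum>x\<in>UNIV. \<Sum>y\<in>UNIV.
        let a = pmf p (x, y) * pmf (Q x) v;
            pvy = (\<Sum>x'\<in>UNIV. pmf p (x', y) * pmf (Q x') v);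
            py = pmf (map_pmf snd p) y
        in if a > 0 then a * log 2 ((a * py) / (pvy * pmf p (x, y))) else 0)"

text \<open>Conditional graph entropy H(G_{X|Y}) = min I(V;X|Y) (the minimum is attained,
  so it coincides with the infimum used here).\<close>
definition cond_graph_entropy :: "('x::finite \<times> 'y::finite) pmf \<Rightarrow> ('x \<Rightarrow> 'y \<Rightarrow> 'f) \<Rightarrow> real" where
  "cond_graph_entropy p f = Inf {cond_mutual_info p Q | Q. admissible_V p f Q}"

end

theory Submission
  imports Defs
begin

text \<open>
  Since \<open>R\<^sub>Y > R\<^sub>0 + H(Y)\<close>, the encoder of \<open>Y\<close> can forward both \<open>\<phi>\<^sub>0(X)\<close> and a lossless description of
  \<open>Y\<close>, so the problem is point-to-point coding at rate \<open>R\<^sub>0 + R\<^sub>X\<close> with side information \<open>Y\<close> at the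
  decoder.

  Achievability: for an admissible \<open>V\<close> take a random codebook of \<open>V\<close>-sequences, partitioned into
  bins; the encoder sends a bin index and the decoder looks for the sequence of the bin that fits \<open>Y\<close>.
  Instead of a typicality encoder, the encoder picks the bin with the smallest conditional error
  probability. That minimum is at most the average over all codewords weighted by the likelihood
  ratios \<open>P(v | x) / P(v)\<close>, whose total is close to 1 (soft covering), and under this weighting
  the triple \<open>(V, X, Y)\<close> has exactly its target law, so no Markov lemma is needed. All
  probabilities of atypical blocks are bounded by exponential moments, which factorise.

  Converse: put \<open>Z\<^sub>i = (\<phi>\<^sub>0(X), \<phi>\<^sub>X(X), Y, X\<^sub>1 \<dots> X\<^sub>i\<^sub>-\<^sub>1)\<close>. It determines the set \<open>D\<^sub>i\<close> of symbols \<open>x\<close> for which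
  the decoder is right at position \<open>i\<close> for every possible \<open>y\<close>; this set is independent. Let \<open>V\<^sub>i = D\<^sub>i\<close>
  if \<open>X\<^sub>i \<in> D\<^sub>i\<close>, and \<open>V\<^sub>i = {X\<^sub>i}\<close> otherwise, which is rare. Then \<open>V\<^sub>i\<close> is admissible, and Gibbs' inequality
  compares \<open>I(V\<^sub>i; X\<^sub>i | Y\<^sub>i)\<close> with entropy differences of the \<open>Z\<^sub>i\<close> that telescope to \<open>n (R\<^sub>0 + R\<^sub>X)\<close>.
\<close>

section \<open>Product sums and large deviations\<close>

lemma finite_seqs [simp]: "finite (seqs n :: (nat \<Rightarrow> 'a::finite) set)"
  by (simp add: seqs_def finite_PiE)

lemma sum_seqs_prod:
  fixes h :: "nat \<Rightarrow> 'a::finite \<Rightarrow> real"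
  shows "(\<Sum>as\<in>seqs n. \<Prod>i<n. h i (as i)) = (\<Prod>i<n. \<Sum>a\<in>UNIV. h i a)"
  unfolding seqs_def by (subst prod_sum_PiE) auto

lemma sum_seqs_prod2:
  fixes h :: "'a::finite \<Rightarrow> 'b::finite \<Rightarrow> real"
  shows "(\<Sum>as\<in>seqs n. \<Sum>bs\<in>seqs n. \<Prod>i<n. h (as i) (bs i)) = (\<Sum>a\<in>UNIV. \<Sum>b\<in>UNIV. h a b) ^ n"
  by (simp add: sum_seqs_prod[of "\<lambda>i. h (as i)" for as] sum_seqs_prod[of "\<lambda>i a. \<Sum>b\<in>UNIV. h a b"])

text \<open>As a function of \<open>t\<close> the sum is 1 at 0, and its derivative there is the
  mean of \<open>s\<close>, which is negative. So it drops below 1 immediately to the right of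
  0.\<close>

lemma exponential_moment_less_1:
  fixes q s :: "'a::finite \<Rightarrow> 'b::finite \<Rightarrow> real"
  assumes sum1: "(\<Sum>a\<in>UNIV. \<Sum>b\<in>UNIV. q a b) = 1"
    and neg: "(\<Sum>a\<in>UNIV. \<Sum>b\<in>UNIV. q a b * s a b) < 0"
  shows "\<exists>t>0. (\<Sum>a\<in>UNIV. \<Sum>b\<in>UNIV. q a b * exp (t * s a b)) < 1"
proof -
  define R where "R t = (\<Sum>a\<in>UNIV. \<Sum>b\<in>UNIV. q a b * exp (t * s a b))" for t
  have "(R has_real_derivative (\<Sum>a\<in>UNIV. \<Sum>b\<in>UNIV. q a b * s a b)) (at 0)"
    unfolding R_def by (auto intro!: derivative_eq_intros sum.cong)
  from DERIV_neg_dec_right[OF this neg] obtain d where d: "d > 0" "\<And>h. 0 < h \<Longrightarrow> h < d \<Longrightarrow> R (0 + h) < R 0"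
    by auto
  have "R (d/2) < R 0" using d(2)[of "d/2"] d(1) by simp
  moreover have "R 0 = 1" by (simp add: R_def sum1)
  ultimately show ?thesis using d(1) unfolding R_def by (intro exI[of _ "d/2"]) simp
qed

text \<open>Markov's inequality for the product of the likelihood ratios raised to a small power.\<close>
lemma likelihood_ratio_deviation:
  fixes q u w :: "'a::finite \<Rightarrow> 'b::finite \<Rightarrow> real"
  assumes q0: "\<And>a b. q a b \<ge> 0"
    and sum1: "(\<Sum>a\<in>UNIV. \<Sum>b\<in>UNIV. q a b) = 1"
    and u: "\<And>a b. q a b > 0 \<Longrightarrow> u a b > 0"
    and w: "\<And>a b. q a b > 0 \<Longrightarrow> w a b > 0"
    and mean: "(\<Sum>a\<in>UNIV. \<Sum>b\<in>UNIV. q a b * log 2 (u a b / w a b)) < \<alpha>"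
  shows "\<exists>r. 0 \<le> r \<and> r < 1 \<and> (\<forall>n. (\<Sum>as\<in>seqs n. \<Sum>bs\<in>seqs n. (\<Prod>i<n. q (as i) (bs i)) *
            of_bool ((\<Prod>i<n. u (as i) (bs i)) > 2 powr (real n * \<alpha>) * (\<Prod>i<n. w (as i) (bs i)))) \<le> r ^ n)"
proof -
  \<comment> \<open>The event to be bounded says that the sum of \<open>s\<close> along the block is
    positive, while \<open>s\<close> has negative mean. Natural logarithms are used because
    \<open>exp\<close> is applied to multiples of \<open>s\<close>.\<close>
  define s where "s a b = ln (u a b / w a b) - \<alpha> * ln 2" for a b
  have "(\<Sum>a\<in>UNIV. \<Sum>b\<in>UNIV. q a b * s a b)
      = ln 2 * (\<Sum>a\<in>UNIV. \<Sum>b\<in>UNIV. q a b * log 2 (u a b / w a b)) - (\<Sum>a\<in>UNIV. \<Sum>b\<in>UNIV. q a b) * (\<alpha> * ln 2)"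
    by (simp add: s_def log_def sum_distrib_left sum_distrib_right sum_subtractf algebra_simps)
  also have "\<dots> = ln 2 * ((\<Sum>a\<in>UNIV. \<Sum>b\<in>UNIV. q a b * log 2 (u a b / w a b)) - \<alpha>)"
    by (simp add: sum1 algebra_simps)
  also have "\<dots> < 0" using mean by (simp add: mult_less_0_iff)
  finally obtain t where t: "t > 0" and less: "(\<Sum>a\<in>UNIV. \<Sum>b\<in>UNIV. q a b * exp (t * s a b)) < 1"
    using exponential_moment_less_1[OF sum1, of s] by blast
  define r where "r = (\<Sum>a\<in>UNIV. \<Sum>b\<in>UNIV. q a b * exp (t * s a b))"
  have "(\<Sum>as\<in>seqs n. \<Sum>bs\<in>seqs n. (\<Prod>i<n. q (as i) (bs i)) *
            of_bool ((\<Prod>i<n. u (as i) (bs i)) > 2 powr (real n * \<alpha>) * (\<Prod>i<n. w (as i) (bs i)))) \<le> r ^ n" for n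
  proof -
    \<comment> \<open>Chernoff bound for each pair of blocks. If some factor of \<open>q\<close> is
      0 the left side vanishes, so the logarithms below are only taken where \<open>u\<close> and
      \<open>w\<close> are positive.\<close>
    have "(\<Prod>i<n. q (as i) (bs i)) *
            of_bool ((\<Prod>i<n. u (as i) (bs i)) > 2 powr (real n * \<alpha>) * (\<Prod>i<n. w (as i) (bs i)))
        \<le> (\<Prod>i<n. q (as i) (bs i) * exp (t * s (as i) (bs i)))" for as bs
    proof (cases "(\<forall>i<n. q (as i) (bs i) > 0) \<and> (\<Prod>i<n. u (as i) (bs i)) > 2 powr (real n * \<alpha>) * (\<Prod>i<n. w (as i) (bs i))")
      case False
      then have "(\<Prod>i<n. q (as i) (bs i)) *
            of_bool ((\<Prod>i<n. u (as i) (bs i)) > 2 powr (real n * \<alpha>) * (\<Prod>i<n. w (as i) (bs i))) = 0"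
        using q0 by (simp add: less_le) force
      also have "\<dots> \<le> (\<Prod>i<n. q (as i) (bs i) * exp (t * s (as i) (bs i)))"
        by (intro prod_nonneg) (auto simp: q0)
      finally show ?thesis .
    next
      case True
      then have up: "\<And>i. i < n \<Longrightarrow> u (as i) (bs i) > 0" and wp: "\<And>i. i < n \<Longrightarrow> w (as i) (bs i) > 0"
        using u w by auto
      have wpos: "(\<Prod>i<n. w (as i) (bs i)) > 0" and upos: "(\<Prod>i<n. u (as i) (bs i)) > 0"
        using up wp by (auto intro!: prod_pos)
      have lnw: "ln (\<Prod>i<n. w (as i) (bs i)) = (\<Sum>i<n. ln (w (as i) (bs i)))"
        using wp by (intro ln_prod) (force, force)
      have lnu: "ln (\<Prod>i<n. u (as i) (bs i)) = (\<Sum>i<n. ln (u (as i) (bs i)))"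
        using up by (intro ln_prod) (force, force)
      have "ln (2 powr (real n * \<alpha>) * (\<Prod>i<n. w (as i) (bs i))) < ln (\<Prod>i<n. u (as i) (bs i))"
        using True wpos by (subst ln_less_cancel_iff) (auto intro: upos)
      then have "real n * \<alpha> * ln 2 + (\<Sum>i<n. ln (w (as i) (bs i))) < (\<Sum>i<n. ln (u (as i) (bs i)))"
        using wpos by (simp add: ln_mult_pos ln_powr lnw lnu)
      moreover have "(\<Sum>i<n. s (as i) (bs i)) = (\<Sum>i<n. ln (u (as i) (bs i)) - ln (w (as i) (bs i)) - \<alpha> * ln 2)"
        using up wp by (intro sum.cong refl) (simp add: s_def ln_divide_pos)
      ultimately have "(\<Sum>i<n. s (as i) (bs i)) > 0"
        by (simp add: sum_subtractf)
      then have "1 \<le> exp (t * (\<Sum>i<n. s (as i) (bs i)))" using t by simp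
      also have "\<dots> = (\<Prod>i<n. exp (t * s (as i) (bs i)))"
        by (simp add: exp_sum sum_distrib_left)
      finally have "(\<Prod>i<n. q (as i) (bs i)) * 1 \<le> (\<Prod>i<n. q (as i) (bs i)) * (\<Prod>i<n. exp (t * s (as i) (bs i)))"
        by (intro mult_left_mono prod_nonneg) (auto simp: q0)
      then show ?thesis using True by (simp add: prod.distrib)
    qed
    then have "(\<Sum>as\<in>seqs n. \<Sum>bs\<in>seqs n. (\<Prod>i<n. q (as i) (bs i)) *
            of_bool ((\<Prod>i<n. u (as i) (bs i)) > 2 powr (real n * \<alpha>) * (\<Prod>i<n. w (as i) (bs i))))
       \<le> (\<Sum>as\<in>seqs n. \<Sum>bs\<in>seqs n. \<Prod>i<n. q (as i) (bs i) * exp (t * s (as i) (bs i)))"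
      by (intro sum_mono)
    also have "\<dots> = r ^ n" unfolding r_def by (rule sum_seqs_prod2)
    finally show ?thesis .
  qed
  moreover have "0 \<le> r" unfolding r_def by (intro sum_nonneg) (auto simp: q0)
  ultimately show ?thesis using less unfolding r_def[symmetric] by blast
qed

section \<open>One-shot coding with side information at the decoder\<close>

lemma sum_iid_prod:
  fixes P :: "'v \<Rightarrow> real"
  assumes "finite I" "finite S"
  shows "(\<Sum>c\<in>I \<rightarrow>\<^sub>E S. (\<Prod>i\<in>I. P (c i)) * (\<Prod>i\<in>I. G i (c i))) = (\<Prod>i\<in>I. \<Sum>v\<in>S. P v * G i v)"
  using assms by (simp add: prod_sum_PiE prod.distrib)

lemma sum_iid_marginal:
  fixes P :: "'v \<Rightarrow> real"
  assumes "finite I" "finite S" "sum P S = 1" "k \<in> I"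
  shows "(\<Sum>c\<in>I \<rightarrow>\<^sub>E S. (\<Prod>i\<in>I. P (c i)) * g (c k)) = (\<Sum>v\<in>S. P v * g v)"
proof -
  have eq: "(\<Prod>i\<in>I. if i = k then g (c i) else 1) = g (c k)" for c
    using assms(1,4) by simp
  have "(\<Sum>v\<in>S. P v * (if i = k then g v else 1)) = (if i = k then \<Sum>v\<in>S. P v * g v else 1)" for i
    using assms(3) by simp
  then show ?thesis
    using sum_iid_prod[OF assms(1,2), of P "\<lambda>i v. if i = k then g v else 1"] assms(1,4)
    by (simp add: eq)
qed

lemma sum_iid_pair:
  fixes P :: "'v \<Rightarrow> real"
  assumes "finite I" "finite S" "sum P S = 1" "k \<in> I" "l \<in> I" "k \<noteq> l"
  shows "(\<Sum>c\<in>I \<rightarrow>\<^sub>E S. (\<Prod>i\<in>I. P (c i)) * (g (c k) * h (c l))) = (\<Sum>v\<in>S. P v * g v) * (\<Sum>v\<in>S. P v * h v)"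
proof -
  have eq: "(\<Prod>i\<in>I. (if i = k then a i else 1) * (if i = l then b i else 1)) = a k * (b l :: real)" for a b
    using assms(1,4,5) by (simp add: prod.distrib)
  have split: "(if i = k then a else if i = l then b else 1) = (if i = k then a else 1) * (if i = l then b else (1::real))" for i a b
    using assms(6) by simp
  have "(\<Sum>v\<in>S. P v * ((if i = k then g v else 1) * (if i = l then h v else 1)))
      = (if i = k then \<Sum>v\<in>S. P v * g v else 1) * (if i = l then \<Sum>v\<in>S. P v * h v else 1)" for i
    using assms(3,6) by simp
  then show ?thesis
    using sum_iid_prod[OF assms(1,2), of P "\<lambda>i v. if i = k then g v else if i = l then h v else 1"]
    by (simp only: split eq)
qed

text \<open>Independence kills the cross terms of the centred function \<open>h\<close>, which
  leaves the variance of one entry divided by \<open>card I\<close>. As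
  \<open>g \<le> \<gamma>\<close> and \<open>g\<close> has mean at most 1, its second moment is at
  most \<open>\<gamma>\<close> and not merely the square of \<open>\<gamma>\<close>. This is the
  soft covering estimate: a codebook much larger than \<open>\<gamma>\<close> has an average close
  to \<open>m\<close>.\<close>

lemma iid_average_second_moment:
  fixes P g :: "'v \<Rightarrow> real"
  assumes fin: "finite I" "I \<noteq> {}" "finite S" and P: "sum P S = 1" "\<And>v. v \<in> S \<Longrightarrow> P v \<ge> 0"
    and g: "\<And>v. v \<in> S \<Longrightarrow> 0 \<le> g v" "\<And>v. v \<in> S \<Longrightarrow> g v \<le> \<gamma>"
    and m: "m = (\<Sum>v\<in>S. P v * g v)" "m \<le> 1" and \<gamma>: "\<gamma> \<ge> 0"
  shows "(\<Sum>c\<in>I \<rightarrow>\<^sub>E S. (\<Prod>i\<in>I. P (c i)) * ((\<Sum>k\<in>I. g (c k)) / card I - m)\<^sup>2) \<le> \<gamma> / card I"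
proof -
  define h where "h v = g v - m" for v
  have K: "real (card I) > 0" using fin by (simp add: card_gt_0_iff)
  have "(\<Sum>v\<in>S. P v * h v) = (\<Sum>v\<in>S. P v * g v) - m * sum P S"
    by (simp add: h_def algebra_simps sum_subtractf sum_distrib_left)
  then have h0: "(\<Sum>v\<in>S. P v * h v) = 0" by (simp add: P(1) m(1))
  have "(\<Sum>v\<in>S. P v * (h v * h v)) = (\<Sum>v\<in>S. P v * (g v * g v)) - 2 * m * (\<Sum>v\<in>S. P v * g v) + m * m * sum P S"
    by (simp add: h_def algebra_simps sum_subtractf sum.distrib sum_distrib_left)
  also have "\<dots> = (\<Sum>v\<in>S. P v * (g v * g v)) - m * m" by (simp add: P(1) m(1)[symmetric])
  also have "\<dots> \<le> (\<Sum>v\<in>S. P v * (g v * g v))" by simp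
  also have "\<dots> \<le> (\<Sum>v\<in>S. \<gamma> * (P v * g v))"
    using mult_right_mono[OF g(2), of _ "P _ * g _"] g P by (intro sum_mono) (simp add: mult_ac)
  also have "\<dots> = \<gamma> * m" by (simp add: m(1) sum_distrib_left)
  also have "\<dots> \<le> \<gamma>" using m(2) \<gamma> by (simp add: mult_left_le)
  finally have var: "(\<Sum>v\<in>S. P v * (h v * h v)) \<le> \<gamma>" .
  have "(\<Sum>k\<in>I. g (c k)) / card I - m = (\<Sum>k\<in>I. h (c k)) / card I" for c
    using K by (simp add: h_def sum_subtractf field_simps)
  then have sq: "((\<Sum>k\<in>I. g (c k)) / card I - m)\<^sup>2 = (\<Sum>k\<in>I. \<Sum>l\<in>I. h (c k) * h (c l)) / (card I)\<^sup>2" for c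
    by (simp add: power_divide power2_eq_square sum_product)
  have "(\<Sum>c\<in>I \<rightarrow>\<^sub>E S. (\<Prod>i\<in>I. P (c i)) * ((\<Sum>k\<in>I. g (c k)) / card I - m)\<^sup>2)
      = (\<Sum>c\<in>I \<rightarrow>\<^sub>E S. \<Sum>k\<in>I. \<Sum>l\<in>I. (\<Prod>i\<in>I. P (c i)) * (h (c k) * h (c l))) / (card I)\<^sup>2"
    unfolding sq by (simp add: sum_distrib_left sum_divide_distrib)
  also have "(\<Sum>c\<in>I \<rightarrow>\<^sub>E S. \<Sum>k\<in>I. \<Sum>l\<in>I. (\<Prod>i\<in>I. P (c i)) * (h (c k) * h (c l)))
      = (\<Sum>k\<in>I. \<Sum>l\<in>I. \<Sum>c\<in>I \<rightarrow>\<^sub>E S. (\<Prod>i\<in>I. P (c i)) * (h (c k) * h (c l)))"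
    by (subst sum.swap, rule sum.cong[OF refl], rule sum.swap)
  also have "\<dots> = (\<Sum>k\<in>I. \<Sum>l\<in>I. if k = l then \<Sum>v\<in>S. P v * (h v * h v) else 0)"
    using sum_iid_pair[OF fin(1,3) P(1), of _ _ h h] sum_iid_marginal[OF fin(1,3) P(1), of _ "\<lambda>v. h v * h v"]
    by (intro sum.cong refl) (auto simp: h0)
  also have "\<dots> = card I * (\<Sum>v\<in>S. P v * (h v * h v))" using fin by simp
  also have "\<dots> / (card I)\<^sup>2 = (\<Sum>v\<in>S. P v * (h v * h v)) / card I"
    using K by (simp add: power2_eq_square)
  also have "\<dots> \<le> \<gamma> / card I" using var K by (simp add: divide_right_mono)
  finally show ?thesis .
qed

lemma weighted_average_le_exists:
  fixes w g :: "'a \<Rightarrow> real"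
  assumes "finite C" "sum w C = 1" "\<And>c. c \<in> C \<Longrightarrow> w c \<ge> 0" "(\<Sum>c\<in>C. w c * g c) \<le> b"
  shows "\<exists>c\<in>C. g c \<le> b"
proof (rule ccontr)
  assume "\<not> ?thesis"
  then have gt: "\<And>c. c \<in> C \<Longrightarrow> g c > b" by force
  have "0 < (\<Sum>c\<in>C. w c * (g c - b))" if "c0 \<in> C" "w c0 > 0" for c0
    using that gt assms(1,3) by (intro sum_pos2[of C c0]) (auto simp: less_imp_le)
  moreover obtain c0 where c0: "c0 \<in> C" "w c0 > 0"
    using assms(2,3) by (metis less_eq_real_def sum.neutral zero_neq_one)
  ultimately have "0 < (\<Sum>c\<in>C. w c * (g c - b))" by blast
  also have "\<dots> = (\<Sum>c\<in>C. w c * g c) - sum w C * b"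
    by (simp add: right_diff_distrib sum_subtractf sum_distrib_right)
  finally show False using assms(2,4) by simp
qed

text \<open>Finite sets instead of finite types, so that one locale covers both single letters and
  blocks in \<open>seqs n\<close>. \<open>p\<close> is the joint law of X and Y, and
  \<open>Q\<close> the conditional law of V given X.\<close>

locale source_with_test_channel =
  fixes SX :: "'a set" and SY :: "'b set" and SV :: "'v set"
    and p :: "'a \<Rightarrow> 'b \<Rightarrow> real" and Q :: "'a \<Rightarrow> 'v \<Rightarrow> real"
  assumes fin: "finite SX" "finite SY" "finite SV"
    and p0: "\<And>x y. p x y \<ge> 0" and Q0: "\<And>x v. Q x v \<ge> 0"
    and p1: "(\<Sum>x\<in>SX. \<Sum>y\<in>SY. p x y) = 1"
    and Q1: "\<And>x. x \<in> SX \<Longrightarrow> (\<Sum>v\<in>SV. Q x v) = 1"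
begin

definition "PX x = (\<Sum>y\<in>SY. p x y)"
definition "PY y = (\<Sum>x\<in>SX. p x y)"
definition "PV v = (\<Sum>x\<in>SX. PX x * Q x v)"
definition "PVY v y = (\<Sum>x\<in>SX. p x y * Q x v)"

lemma PX0: "PX x \<ge> 0" and PY0: "PY y \<ge> 0" and PV0: "PV v \<ge> 0" and PVY0: "PVY v y \<ge> 0"
  by (auto simp: PX_def PY_def PV_def PVY_def p0 Q0 intro!: sum_nonneg mult_nonneg_nonneg)

lemma PX1: "sum PX SX = 1"
  using p1 by (simp add: PX_def)

lemma PV1: "sum PV SV = 1"
proof -
  have "sum PV SV = (\<Sum>x\<in>SX. PX x * (\<Sum>v\<in>SV. Q x v))"
    unfolding PV_def by (subst sum.swap) (simp add: sum_distrib_left)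
  then show ?thesis using Q1 PX1 by simp
qed

lemma PVY1: "(\<Sum>v\<in>SV. \<Sum>y\<in>SY. PVY v y) = 1"
proof -
  have "(\<Sum>v\<in>SV. \<Sum>y\<in>SY. PVY v y) = (\<Sum>v\<in>SV. PV v)"
    unfolding PVY_def PV_def PX_def sum_distrib_right
    by (intro sum.cong refl) (rule sum.swap)
  then show ?thesis using PV1 by simp
qed

end

text \<open>A codebook \<open>c\<close> consists of \<open>B\<close> bins with \<open>J\<close>
  words each; \<open>c (b, j)\<close> is word \<open>j\<close> of bin \<open>b\<close>.
  \<open>\<eta>\<close> is the threshold of the decoder's test, \<open>\<gamma>\<close> the level at
  which likelihood ratios are truncated, and \<open>\<delta>\<close> the tolerated deviation of
  their average.\<close>

locale random_code = source_with_test_channel SX SY SV p Q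
  for SX :: "'a set" and SY :: "'b set" and SV :: "'v set" and p Q +
  fixes B J :: nat and \<gamma> \<eta> \<delta> :: real
  assumes BJ: "B > 0" "J > 0" and \<gamma>: "\<gamma> > 0" and \<eta>: "\<eta> > 0" and \<delta>: "\<delta> > 0"
begin

definition "I = {..<B} \<times> {..<J}"
definition "wt c = (\<Prod>k\<in>I. PV (c k))"
definition "T v y \<longleftrightarrow> \<eta> * PV v * PY y \<le> PVY v y"
text \<open>Arbitrary if no codeword of the bin passes the test; this case counts as a decoding failure.\<close>
definition "dec c b y = c (b, SOME j. j < J \<and> T (c (b, j)) y)"
text \<open>The joint mass of the source value \<open>x\<close> and a decoding failure when bin
  \<open>b\<close> is sent, without division by \<open>PX x\<close>. Failure means a decoded word to
  which \<open>Q x\<close> gives no mass.\<close>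

definition "e c x b = (\<Sum>y\<in>SY. p x y * of_bool (\<not> Q x (dec c b y) > 0))"
text \<open>Truncation bounds the ratio by \<open>\<gamma>\<close>, as the second moment estimate
  requires. The price is that its mean \<open>q x\<close> falls short of 1 by the
  \<open>Q x\<close>-mass of the removed words, see \<open>one_minus_q\<close>.\<close>

definition "L x v = (if Q x v \<le> \<gamma> * PV v then Q x v / PV v else 0)"
definition "q x = (\<Sum>v\<in>SV. PV v * L x v)"

lemma finI: "finite I" and cardI: "card I = B * J" and I_ne: "I \<noteq> {}"
  using BJ by (auto simp: I_def)

lemma wt0: "wt c \<ge> 0"
  unfolding wt_def by (intro prod_nonneg) (auto simp: PV0)

lemma wt1: "(\<Sum>c\<in>I \<rightarrow>\<^sub>E SV. wt c) = 1"
  using sum_iid_prod[OF finI fin(3), of PV "\<lambda>_ _. 1"] PV1 by (simp add: wt_def)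

lemma wt_marginal: "k \<in> I \<Longrightarrow> (\<Sum>c\<in>I \<rightarrow>\<^sub>E SV. wt c * g (c k)) = (\<Sum>v\<in>SV. PV v * g v)"
  unfolding wt_def by (rule sum_iid_marginal[OF finI fin(3) PV1])

lemma wt_pair: "k \<in> I \<Longrightarrow> l \<in> I \<Longrightarrow> k \<noteq> l \<Longrightarrow>
    (\<Sum>c\<in>I \<rightarrow>\<^sub>E SV. wt c * (g (c k) * h (c l))) = (\<Sum>v\<in>SV. PV v * g v) * (\<Sum>v\<in>SV. PV v * h v)"
  unfolding wt_def by (rule sum_iid_pair[OF finI fin(3) PV1])

lemma L0: "L x v \<ge> 0" and L_le: "L x v \<le> \<gamma>"
proof -
  show "L x v \<ge> 0" using Q0 PV0 by (simp add: L_def)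
  show "L x v \<le> \<gamma>"
    using \<gamma> PV0[of v] by (cases "PV v = 0") (auto simp: L_def divide_le_eq)
qed

lemma PV_L: "PV v * L x v = Q x v - Q x v * of_bool (Q x v > \<gamma> * PV v)"
  using Q0[of x v] by (cases "PV v = 0") (auto simp: L_def)

lemma PV_L_le: "PV v * L x v \<le> Q x v"
  unfolding PV_L using Q0[of x v] by simp

lemma q_le_1: "x \<in> SX \<Longrightarrow> q x \<le> 1"
  unfolding q_def using sum_mono[of SV "\<lambda>v. PV v * L x v" "Q x"] PV_L_le Q1 by simp

lemma one_minus_q: "x \<in> SX \<Longrightarrow> 1 - q x = (\<Sum>v\<in>SV. Q x v * of_bool (Q x v > \<gamma> * PV v))"
  unfolding q_def PV_L using Q1 by (simp add: sum_subtractf)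

lemma e0: "e c x b \<ge> 0" and e_le: "e c x b \<le> PX x"
  unfolding e_def PX_def by (auto simp: p0 intro!: sum_nonneg sum_mono)

text \<open>The encoder picks the best bin. Comparing the minimum with the average over all codewords,
  weighted by the truncated likelihood ratios, costs only the deviation of the total weight from 1.\<close>
lemma best_bin_le:
  assumes x: "x \<in> SX"
  shows "Min (e c x ` {..<B}) \<le> (\<Sum>k\<in>I. L x (c k) * e c x (fst k)) / card I
     + PX x * ((1 - q x) + \<delta> / 2 + ((\<Sum>k\<in>I. L x (c k)) / card I - q x)\<^sup>2 / (2 * \<delta>))"
proof -
  define m where "m = Min (e c x ` {..<B})"
  define A where "A = (\<Sum>k\<in>I. L x (c k)) / card I"
  have K: "real (card I) > 0" using BJ by (simp add: cardI)
  have "m \<in> e c x ` {..<B}" unfolding m_def using BJ by (intro Min_in) auto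
  then have m: "0 \<le> m" "m \<le> PX x" using e0 e_le by auto
  have m_le: "m \<le> e c x b" if "b < B" for b
    unfolding m_def using that by (intro Min_le) auto
  \<comment> \<open>Split \<open>m\<close> as \<open>m * A + m * (1 - A)\<close>. In the first term
    \<open>m\<close> may be replaced by the failure mass of any bin; in the second,
    \<open>1 - A\<close> is small on average and \<open>m\<close> is at most
    \<open>PX x\<close>.\<close>
  have "m * A = (\<Sum>k\<in>I. L x (c k) * m) / card I"
    by (simp add: A_def sum_distrib_left mult.commute)
  also have "\<dots> \<le> (\<Sum>k\<in>I. L x (c k) * e c x (fst k)) / card I"
    using K by (intro divide_right_mono sum_mono mult_left_mono m_le L0) (auto simp: I_def)
  finally have 1: "m * A \<le> (\<Sum>k\<in>I. L x (c k) * e c x (fst k)) / card I" .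
  \<comment> \<open>The absolute deviation is traded for a squared one, whose expectation over
    codebooks is a variance.\<close>
  have "2 * \<delta> * \<bar>A - q x\<bar> \<le> \<delta>\<^sup>2 + (A - q x)\<^sup>2"
    using sum_squares_bound[of \<delta> "\<bar>A - q x\<bar>"] by simp
  then have "\<bar>A - q x\<bar> \<le> \<delta> / 2 + (A - q x)\<^sup>2 / (2 * \<delta>)"
    using \<delta> by (simp add: field_simps power2_eq_square)
  then have le: "1 - A \<le> (1 - q x) + \<delta> / 2 + (A - q x)\<^sup>2 / (2 * \<delta>)" by linarith
  have "m * (1 - A) \<le> m * ((1 - q x) + \<delta> / 2 + (A - q x)\<^sup>2 / (2 * \<delta>))"
    using le m by (intro mult_left_mono)
  also have "\<dots> \<le> PX x * ((1 - q x) + \<delta> / 2 + (A - q x)\<^sup>2 / (2 * \<delta>))"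
    using m q_le_1[OF x] \<delta> by (intro mult_right_mono) auto
  finally show ?thesis using 1 unfolding m_def A_def by (simp add: algebra_simps)
qed

text \<open>If word \<open>(b, j)\<close> passes the test and no other word of its bin does, the
  decoder returns it, and a positive weight \<open>L\<close> means that \<open>Q x\<close> allows
  it. Every remaining case is charged to the word itself or, by a union bound, to a
  competitor.\<close>

lemma decoding_failure_le:
  assumes b: "b < B" and j: "j < J"
  shows "L x (c (b, j)) * of_bool (\<not> Q x (dec c b y) > 0)
    \<le> L x (c (b, j)) * of_bool (\<not> T (c (b, j)) y)
      + (\<Sum>j'\<in>{..<J} - {j}. L x (c (b, j)) * of_bool (T (c (b, j')) y))"
proof (cases "L x (c (b, j)) > 0 \<and> T (c (b, j)) y \<and> (\<forall>j'\<in>{..<J} - {j}. \<not> T (c (b, j')) y)")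
  case True
  then have "(SOME j. j < J \<and> T (c (b, j)) y) = j"
    using j by (intro some_equality) auto
  then have "dec c b y = c (b, j)" by (simp add: dec_def)
  moreover have "Q x (c (b, j)) > 0"
    using True Q0[of x "c (b, j)"] by (auto simp: L_def less_le split: if_splits)
  ultimately show ?thesis using L0 by (auto intro!: add_nonneg_nonneg sum_nonneg)
next
  case False
  have nn: "0 \<le> (\<Sum>j'\<in>{..<J} - {j}. L x (c (b, j)) * of_bool (T (c (b, j')) y))"
    by (intro sum_nonneg) (simp add: L0)
  consider "L x (c (b, j)) = 0" | "\<not> T (c (b, j)) y" | j' where "j' \<in> {..<J} - {j}" "T (c (b, j')) y"
    using False L0[of x "c (b, j)"] by (metis less_le)
  then show ?thesis
  proof cases
    case 3
    have "L x (c (b, j)) * of_bool (T (c (b, j')) y) \<le> (\<Sum>j'\<in>{..<J} - {j}. L x (c (b, j)) * of_bool (T (c (b, j')) y))"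
      using 3 by (intro member_le_sum) (auto simp: L0)
    moreover have "0 \<le> L x (c (b, j)) * of_bool (\<not> T (c (b, j)) y)" by (simp add: L0)
    ultimately show ?thesis using 3 L0[of x "c (b, j)"] by (simp add: of_bool_def split: if_splits)
  qed (use nn L0[of x "c (b, j)"] in auto)
qed

text \<open>Under the weight \<open>L x\<close>, the law of word \<open>k\<close> changes from
  \<open>PV\<close> to at most \<open>Q x\<close>, the conditional law of V given \<open>x\<close>.
  Its \<open>J - 1\<close> competitors are independent of it and keep the law \<open>PV\<close>; the
  weight then contributes only the factor \<open>q x\<close>, which is at most 1.\<close>

lemma expected_decoding_failure_le:
  assumes x: "x \<in> SX" and k: "k \<in> I"
  shows "(\<Sum>c\<in>I \<rightarrow>\<^sub>E SV. wt c * (L x (c k) * e c x (fst k)))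
    \<le> (\<Sum>y\<in>SY. p x y * ((\<Sum>v\<in>SV. Q x v * of_bool (\<not> T v y)) + (real J - 1) * (\<Sum>v\<in>SV. PV v * of_bool (T v y))))"
proof -
  obtain b j where bj: "k = (b, j)" "b < B" "j < J" using k by (auto simp: I_def)
  have each: "(\<Sum>c\<in>I \<rightarrow>\<^sub>E SV. wt c * (L x (c k) * of_bool (\<not> Q x (dec c b y) > 0)))
      \<le> (\<Sum>v\<in>SV. Q x v * of_bool (\<not> T v y)) + (real J - 1) * (\<Sum>v\<in>SV. PV v * of_bool (T v y))" for y
  proof -
    have "(\<Sum>c\<in>I \<rightarrow>\<^sub>E SV. wt c * (L x (c k) * of_bool (\<not> Q x (dec c b y) > 0)))
      \<le> (\<Sum>c\<in>I \<rightarrow>\<^sub>E SV. wt c * (L x (c k) * of_bool (\<not> T (c k) y)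
           + (\<Sum>j'\<in>{..<J} - {j}. L x (c k) * of_bool (T (c (b, j')) y))))"
      unfolding bj(1) by (intro sum_mono mult_left_mono decoding_failure_le bj wt0)
    also have "\<dots> = (\<Sum>c\<in>I \<rightarrow>\<^sub>E SV. wt c * (L x (c k) * of_bool (\<not> T (c k) y)))
        + (\<Sum>j'\<in>{..<J} - {j}. \<Sum>c\<in>I \<rightarrow>\<^sub>E SV. wt c * (L x (c k) * of_bool (T (c (b, j')) y)))"
      unfolding distrib_left sum.distrib sum_distrib_left by (rule arg_cong[OF sum.swap])
    also have "(\<Sum>c\<in>I \<rightarrow>\<^sub>E SV. wt c * (L x (c k) * of_bool (\<not> T (c k) y)))
        = (\<Sum>v\<in>SV. (PV v * L x v) * of_bool (\<not> T v y))"
      using wt_marginal[OF k, of "\<lambda>v. L x v * of_bool (\<not> T v y)"] by (simp add: mult.assoc)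
    also have "\<dots> \<le> (\<Sum>v\<in>SV. Q x v * of_bool (\<not> T v y))"
      by (intro sum_mono mult_right_mono PV_L_le) simp
    also have "(\<Sum>j'\<in>{..<J} - {j}. \<Sum>c\<in>I \<rightarrow>\<^sub>E SV. wt c * (L x (c k) * of_bool (T (c (b, j')) y)))
       = (\<Sum>j'\<in>{..<J} - {j}. q x * (\<Sum>v\<in>SV. PV v * of_bool (T v y)))"
      unfolding q_def
      by (intro sum.cong refl wt_pair[OF k, of _ "L x" "\<lambda>v. of_bool (T v y)"]) (use bj in \<open>auto simp: I_def\<close>)
    also have "\<dots> = (real J - 1) * (q x * (\<Sum>v\<in>SV. PV v * of_bool (T v y)))"
      using bj BJ by (simp add: of_nat_diff)
    also have "\<dots> \<le> (real J - 1) * (1 * (\<Sum>v\<in>SV. PV v * of_bool (T v y)))"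
      using BJ q_le_1[OF x] by (intro mult_left_mono mult_right_mono sum_nonneg) (auto simp: PV0)
    finally show ?thesis by simp
  qed
  have "(\<Sum>c\<in>I \<rightarrow>\<^sub>E SV. wt c * (L x (c k) * e c x (fst k)))
      = (\<Sum>c\<in>I \<rightarrow>\<^sub>E SV. \<Sum>y\<in>SY. p x y * (wt c * (L x (c k) * of_bool (\<not> Q x (dec c b y) > 0))))"
    unfolding e_def bj(1) by (simp add: sum_distrib_left mult_ac)
  also have "\<dots> = (\<Sum>y\<in>SY. p x y * (\<Sum>c\<in>I \<rightarrow>\<^sub>E SV. wt c * (L x (c k) * of_bool (\<not> Q x (dec c b y) > 0))))"
    by (subst sum.swap) (simp add: sum_distrib_left)
  also have "\<dots> \<le> (\<Sum>y\<in>SY. p x y * ((\<Sum>v\<in>SV. Q x v * of_bool (\<not> T v y)) + (real J - 1) * (\<Sum>v\<in>SV. PV v * of_bool (T v y))))"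
    by (intro sum_mono mult_left_mono each p0)
  finally show ?thesis .
qed

text \<open>The codebook average of \<open>best_bin_le\<close>: the failure bound is the same for
  all words, and the squared deviation is the second moment of an average of \<open>B * J\<close>
  independent terms.\<close>

lemma expected_best_bin_le:
  assumes x: "x \<in> SX"
  shows "(\<Sum>c\<in>I \<rightarrow>\<^sub>E SV. wt c * Min (e c x ` {..<B}))
    \<le> (\<Sum>y\<in>SY. p x y * ((\<Sum>v\<in>SV. Q x v * of_bool (\<not> T v y)) + (real J - 1) * (\<Sum>v\<in>SV. PV v * of_bool (T v y))))
      + PX x * ((1 - q x) + \<delta> / 2 + \<gamma> / (2 * \<delta> * (real B * real J)))" (is "?l \<le> ?a + _")
proof -
  have K: "real (card I) > 0" using BJ by (simp add: cardI)
  have "?l \<le> (\<Sum>c\<in>I \<rightarrow>\<^sub>E SV. wt c * ((\<Sum>k\<in>I. L x (c k) * e c x (fst k)) / card I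
     + PX x * ((1 - q x) + \<delta> / 2 + ((\<Sum>k\<in>I. L x (c k)) / card I - q x)\<^sup>2 / (2 * \<delta>))))"
    by (intro sum_mono mult_left_mono best_bin_le x wt0)
  also have "\<dots> = (\<Sum>c\<in>I \<rightarrow>\<^sub>E SV. \<Sum>k\<in>I. wt c * (L x (c k) * e c x (fst k))) / card I
     + PX x * (((1 - q x) + \<delta> / 2) * (\<Sum>c\<in>I \<rightarrow>\<^sub>E SV. wt c)
       + (\<Sum>c\<in>I \<rightarrow>\<^sub>E SV. wt c * ((\<Sum>k\<in>I. L x (c k)) / card I - q x)\<^sup>2) / (2 * \<delta>))"
    by (simp only: distrib_left sum.distrib sum_distrib_left sum_divide_distrib mult_ac times_divide_eq_right times_divide_eq_left)
  also have "(\<Sum>c\<in>I \<rightarrow>\<^sub>E SV. \<Sum>k\<in>I. wt c * (L x (c k) * e c x (fst k)))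
      = (\<Sum>k\<in>I. \<Sum>c\<in>I \<rightarrow>\<^sub>E SV. wt c * (L x (c k) * e c x (fst k)))"
    by (rule sum.swap)
  also have "\<dots> / card I \<le> (\<Sum>k\<in>I. ?a) / card I"
    using K by (intro divide_right_mono sum_mono expected_decoding_failure_le x) auto
  also have "\<dots> = ?a" using K by simp
  also have "PX x * (((1 - q x) + \<delta> / 2) * (\<Sum>c\<in>I \<rightarrow>\<^sub>E SV. wt c)
       + (\<Sum>c\<in>I \<rightarrow>\<^sub>E SV. wt c * ((\<Sum>k\<in>I. L x (c k)) / card I - q x)\<^sup>2) / (2 * \<delta>))
     \<le> PX x * (((1 - q x) + \<delta> / 2) * 1 + (\<gamma> / card I) / (2 * \<delta>))"
    unfolding wt1 unfolding wt_def
    using \<delta> \<gamma> q_le_1[OF x] PX0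
    by (intro mult_left_mono add_left_mono divide_right_mono iid_average_second_moment finI I_ne fin PV1)
       (auto simp: q_def PV0 L0 L_le)
  finally show ?thesis by (simp add: cardI mult_ac)
qed

text \<open>The terms of the bound are, in order: the right word fails the test, a wrong word passes
  it, the truncation loss, and two for the deviation of the total weight. The bound holds for the
  average over codebooks, hence for some codebook.\<close>

lemma exists_code:
  "\<exists>(enc :: 'a \<Rightarrow> nat) (dc :: nat \<Rightarrow> 'b \<Rightarrow> 'v). (\<forall>x. enc x < B) \<and>
     (\<Sum>x\<in>SX. \<Sum>y\<in>SY. p x y * of_bool (\<not> Q x (dc (enc x) y) > 0))
     \<le> (\<Sum>v\<in>SV. \<Sum>y\<in>SY. PVY v y * of_bool (\<eta> * PV v * PY y > PVY v y)) + (real J - 1) / \<eta>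
       + (\<Sum>x\<in>SX. \<Sum>v\<in>SV. PX x * Q x v * of_bool (Q x v > \<gamma> * PV v))
       + \<delta> / 2 + \<gamma> / (2 * \<delta> * (real B * real J))"
proof -
  have t1: "(\<Sum>x\<in>SX. \<Sum>y\<in>SY. p x y * (\<Sum>v\<in>SV. Q x v * of_bool (\<not> T v y)))
     = (\<Sum>v\<in>SV. \<Sum>y\<in>SY. PVY v y * of_bool (\<eta> * PV v * PY y > PVY v y))"
  proof -
    have "(\<Sum>x\<in>SX. \<Sum>y\<in>SY. p x y * (\<Sum>v\<in>SV. Q x v * of_bool (\<not> T v y)))
       = (\<Sum>x\<in>SX. \<Sum>y\<in>SY. \<Sum>v\<in>SV. p x y * Q x v * of_bool (\<not> T v y))"
      by (simp add: sum_distrib_left mult.assoc)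
    also have "\<dots> = (\<Sum>y\<in>SY. \<Sum>x\<in>SX. \<Sum>v\<in>SV. p x y * Q x v * of_bool (\<not> T v y))"
      by (rule sum.swap)
    also have "\<dots> = (\<Sum>y\<in>SY. \<Sum>v\<in>SV. \<Sum>x\<in>SX. p x y * Q x v * of_bool (\<not> T v y))"
      by (intro sum.cong refl sum.swap)
    also have "\<dots> = (\<Sum>v\<in>SV. \<Sum>y\<in>SY. \<Sum>x\<in>SX. p x y * Q x v * of_bool (\<not> T v y))"
      by (rule sum.swap)
    finally show ?thesis by (simp add: PVY_def T_def sum_distrib_right not_le)
  qed
  \<comment> \<open>On pairs that pass the test the product law is at most \<open>1 / \<eta>\<close>
    times the joint law, so it gives them mass at most \<open>1 / \<eta>\<close>.\<close>
  have t2: "(\<Sum>x\<in>SX. \<Sum>y\<in>SY. p x y * ((real J - 1) * (\<Sum>v\<in>SV. PV v * of_bool (T v y)))) \<le> (real J - 1) / \<eta>"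
  proof -
    have "(\<Sum>x\<in>SX. \<Sum>y\<in>SY. p x y * ((real J - 1) * (\<Sum>v\<in>SV. PV v * of_bool (T v y))))
      = (\<Sum>y\<in>SY. PY y * ((real J - 1) * (\<Sum>v\<in>SV. PV v * of_bool (T v y))))"
      by (subst sum.swap) (simp add: PY_def sum_distrib_right)
    also have "\<dots> = (real J - 1) * (\<Sum>y\<in>SY. \<Sum>v\<in>SV. PV v * PY y * of_bool (T v y))"
      by (simp add: sum_distrib_left mult_ac)
    also have "\<dots> \<le> (real J - 1) * (\<Sum>y\<in>SY. \<Sum>v\<in>SV. PVY v y / \<eta>)"
      using BJ \<eta> PVY0 by (intro mult_left_mono sum_mono) (auto simp: T_def field_simps)
    also have "(\<Sum>y\<in>SY. \<Sum>v\<in>SV. PVY v y / \<eta>) = (\<Sum>v\<in>SV. \<Sum>y\<in>SY. PVY v y) / \<eta>"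
      by (subst sum.swap) (simp add: sum_divide_distrib)
    finally show ?thesis by (simp add: PVY1)
  qed
  have t3: "(\<Sum>x\<in>SX. PX x * (1 - q x)) = (\<Sum>x\<in>SX. \<Sum>v\<in>SV. PX x * Q x v * of_bool (Q x v > \<gamma> * PV v))"
    by (simp add: one_minus_q sum_distrib_left mult.assoc)
  define b where "b = (\<Sum>v\<in>SV. \<Sum>y\<in>SY. PVY v y * of_bool (\<eta> * PV v * PY y > PVY v y)) + (real J - 1) / \<eta>
       + (\<Sum>x\<in>SX. \<Sum>v\<in>SV. PX x * Q x v * of_bool (Q x v > \<gamma> * PV v))
       + \<delta> / 2 + \<gamma> / (2 * \<delta> * (real B * real J))"
  have "(\<Sum>c\<in>I \<rightarrow>\<^sub>E SV. wt c * (\<Sum>x\<in>SX. Min (e c x ` {..<B})))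
     = (\<Sum>x\<in>SX. \<Sum>c\<in>I \<rightarrow>\<^sub>E SV. wt c * Min (e c x ` {..<B}))"
    by (subst sum.swap) (simp add: sum_distrib_left)
  also have "\<dots> \<le> (\<Sum>x\<in>SX. (\<Sum>y\<in>SY. p x y * ((\<Sum>v\<in>SV. Q x v * of_bool (\<not> T v y)) + (real J - 1) * (\<Sum>v\<in>SV. PV v * of_bool (T v y))))
      + PX x * ((1 - q x) + \<delta> / 2 + \<gamma> / (2 * \<delta> * (real B * real J))))"
    by (intro sum_mono expected_best_bin_le)
  also have "\<dots> = (\<Sum>x\<in>SX. \<Sum>y\<in>SY. p x y * (\<Sum>v\<in>SV. Q x v * of_bool (\<not> T v y)))
     + (\<Sum>x\<in>SX. \<Sum>y\<in>SY. p x y * ((real J - 1) * (\<Sum>v\<in>SV. PV v * of_bool (T v y))))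
     + (\<Sum>x\<in>SX. PX x * (1 - q x)) + sum PX SX * (\<delta> / 2) + sum PX SX * (\<gamma> / (2 * \<delta> * (real B * real J)))"
    by (simp only: distrib_left sum.distrib sum_distrib_right add.assoc)
  also have "\<dots> \<le> b" using t1 t2 t3 by (simp add: b_def PX1)
  finally have "(\<Sum>c\<in>I \<rightarrow>\<^sub>E SV. wt c * (\<Sum>x\<in>SX. Min (e c x ` {..<B}))) \<le> b" .
  then obtain c where c: "(\<Sum>x\<in>SX. Min (e c x ` {..<B})) \<le> b"
    using weighted_average_le_exists[OF _ wt1, of "\<lambda>c. \<Sum>x\<in>SX. Min (e c x ` {..<B})" b] wt0 finI fin
    by (auto simp: finite_PiE)
  have "\<forall>x. \<exists>b. b < B \<and> e c x b = Min (e c x ` {..<B})"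
  proof
    fix x
    have "Min (e c x ` {..<B}) \<in> e c x ` {..<B}" using BJ by (intro Min_in) auto
    then show "\<exists>b. b < B \<and> e c x b = Min (e c x ` {..<B})" by auto
  qed
  then obtain enc where enc: "\<And>x. enc x < B \<and> e c x (enc x) = Min (e c x ` {..<B})" by metis
  then have "(\<Sum>x\<in>SX. \<Sum>y\<in>SY. p x y * of_bool (\<not> Q x (dec c (enc x) y) > 0)) \<le> b"
    using c by (simp flip: e_def)
  then show ?thesis using enc unfolding b_def by blast
qed

end

section \<open>Block codes for memoryless sources\<close>

locale memoryless_source = source_with_test_channel UNIV UNIV UNIV p Q
  for p :: "'x::finite \<Rightarrow> 'y::finite \<Rightarrow> real" and Q :: "'x \<Rightarrow> 'v::finite \<Rightarrow> real"
begin

definition "block_p n xs ys = (\<Prod>i<n. p (xs i) (ys i))"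
definition "block_Q n xs vs = (\<Prod>i<n. Q (xs i) (vs i))"
text \<open>\<open>IX\<close> is the mutual information of X and V, and \<open>IY\<close> below is
  that of V and Y, both in bits.\<close>

definition "IX = (\<Sum>x\<in>UNIV. \<Sum>v\<in>UNIV. PX x * Q x v * log 2 (Q x v / PV v))"
definition "IY = (\<Sum>v\<in>UNIV. \<Sum>y\<in>UNIV. PVY v y * log 2 (PVY v y / (PV v * PY y)))"

lemma PXQ1: "(\<Sum>x\<in>UNIV. \<Sum>v\<in>UNIV. PX x * Q x v) = 1"
  using Q1 PX1 by (simp flip: sum_distrib_left)

lemma block_source: "source_with_test_channel (seqs n) (seqs n) (seqs n) (block_p n) (block_Q n)"
proof
  show "(\<Sum>xs\<in>seqs n. \<Sum>ys\<in>seqs n. block_p n xs ys) = 1"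
    unfolding block_p_def by (simp add: sum_seqs_prod2 p1)
  show "(\<Sum>vs\<in>seqs n. block_Q n xs vs) = 1" for xs
    unfolding block_Q_def by (simp add: sum_seqs_prod[of "\<lambda>i. Q (xs i)"] Q1)
qed (auto simp: block_p_def block_Q_def p0 Q0 intro!: prod_nonneg)

interpretation block: source_with_test_channel "seqs n" "seqs n" "seqs n" "block_p n" "block_Q n" for n
  by (rule block_source)

lemma block_PX: "block.PX n xs = (\<Prod>i<n. PX (xs i))"
  unfolding block.PX_def block_p_def PX_def by (rule sum_seqs_prod)

lemma block_PY: "block.PY n ys = (\<Prod>i<n. PY (ys i))"
  unfolding block.PY_def block_p_def PY_def by (rule sum_seqs_prod)

lemma block_PV: "block.PV n vs = (\<Prod>i<n. PV (vs i))"
  unfolding block.PV_def block_Q_def PV_def block_PX prod.distrib[symmetric]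
  by (rule sum_seqs_prod)

lemma block_PVY: "block.PVY n vs ys = (\<Prod>i<n. PVY (vs i) (ys i))"
  unfolding block.PVY_def block_Q_def block_p_def PVY_def prod.distrib[symmetric]
  by (rule sum_seqs_prod)

lemma PX_pos: "p x y > 0 \<Longrightarrow> PX x > 0"
  unfolding PX_def by (rule sum_pos2[of _ y]) (auto simp: p0)

lemma PY_pos: "p x y > 0 \<Longrightarrow> PY y > 0"
  unfolding PY_def by (rule sum_pos2[of _ x]) (auto simp: p0)

lemma PV_pos: "PX x * Q x v > 0 \<Longrightarrow> PV v > 0"
  unfolding PV_def by (rule sum_pos2[of _ x]) (auto simp: PX0 Q0)

lemma PVY_pos_iff: "PVY v y > 0 \<longleftrightarrow> (\<exists>x. p x y * Q x v > 0)"
proof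
  assume "PVY v y > 0"
  then show "\<exists>x. p x y * Q x v > 0"
    unfolding PVY_def by (metis (no_types, lifting) sum_nonpos not_le)
next
  assume "\<exists>x. p x y * Q x v > 0"
  then show "PVY v y > 0"
    unfolding PVY_def using p0 Q0 by (auto intro!: sum_pos2)
qed

lemma PVY_pos_imp: "PVY v y > 0 \<Longrightarrow> PV v > 0 \<and> PY y > 0"
  unfolding PVY_pos_iff using p0 Q0 PX_pos PY_pos PV_pos
  by (metis less_le mult_eq_0_iff mult_pos_pos)

text \<open>The test fails on a downward deviation, whereas
  \<open>likelihood_ratio_deviation\<close> bounds upward ones. So it is applied to the inverse
  ratio, with mean \<open>- IY\<close> and level \<open>- (IY - d)\<close>.\<close>

lemma typical_side_information:
  assumes "d > 0"
  shows "\<exists>r. 0 \<le> r \<and> r < 1 \<and> (\<forall>n. (\<Sum>vs\<in>seqs n. \<Sum>ys\<in>seqs n. block.PVY n vs ys *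
       of_bool (2 powr (real n * (IY - d)) * block.PV n vs * block.PY n ys > block.PVY n vs ys)) \<le> r ^ n)"
proof -
  have "(\<Sum>v\<in>UNIV. \<Sum>y\<in>UNIV. PVY v y * log 2 (PV v * PY y / PVY v y)) = - IY"
    unfolding IY_def sum_negf[symmetric]
  proof (intro sum.cong refl)
    fix v y
    show "PVY v y * log 2 (PV v * PY y / PVY v y) = - (PVY v y * log 2 (PVY v y / (PV v * PY y)))"
      using log_inverse[of 2 "PVY v y / (PV v * PY y)"] by simp
  qed
  then have mean: "(\<Sum>v\<in>UNIV. \<Sum>y\<in>UNIV. PVY v y * log 2 (PV v * PY y / PVY v y)) < - (IY - d)"
    using assms by simp
  have iff: "2 powr (real n * (IY - d)) * block.PV n vs * block.PY n ys > block.PVY n vs ys \<longleftrightarrow>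
      (\<Prod>i<n. PV (vs i) * PY (ys i)) > 2 powr (real n * - (IY - d)) * (\<Prod>i<n. PVY (vs i) (ys i))" for n vs ys
  proof -
    have "b < c * a \<longleftrightarrow> inverse c * b < a" if "c > 0" for a b c :: real
      using that by (simp add: field_simps)
    then show ?thesis
      by (simp only: block_PVY block_PV block_PY mult_minus_right powr_minus powr_gt_zero mult.assoc prod.distrib)
  qed
  have "\<exists>r. 0 \<le> r \<and> r < 1 \<and> (\<forall>n. (\<Sum>vs\<in>seqs n. \<Sum>ys\<in>seqs n. (\<Prod>i<n. PVY (vs i) (ys i)) *
      of_bool ((\<Prod>i<n. PV (vs i) * PY (ys i)) > 2 powr (real n * - (IY - d)) * (\<Prod>i<n. PVY (vs i) (ys i)))) \<le> r ^ n)"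
    using PVY_pos_imp by (intro likelihood_ratio_deviation[OF PVY0 PVY1 _ _ mean]) auto
  then show ?thesis unfolding iff unfolding block_PVY .
qed

lemma typical_test_channel:
  assumes "d > 0"
  shows "\<exists>r. 0 \<le> r \<and> r < 1 \<and> (\<forall>n. (\<Sum>xs\<in>seqs n. \<Sum>vs\<in>seqs n. block.PX n xs * block_Q n xs vs *
       of_bool (block_Q n xs vs > 2 powr (real n * (IX + d)) * block.PV n vs)) \<le> r ^ n)"
proof -
  have mean: "(\<Sum>x\<in>UNIV. \<Sum>v\<in>UNIV. PX x * Q x v * log 2 (Q x v / PV v)) < IX + d"
    using assms by (simp add: IX_def)
  have "PX x * Q x v > 0 \<Longrightarrow> Q x v > 0" for x v
    using Q0[of x v] PX0[of x] by (simp add: zero_less_mult_iff)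
  then show ?thesis
    using likelihood_ratio_deviation[OF _ PXQ1 _ _ mean] PV_pos PX0 Q0
    unfolding block_Q_def block_PV block_PX by (simp add: prod.distrib)
qed

text \<open>The slack \<open>4 * d\<close> is shared out as follows: \<open>J\<close> is about
  \<open>2 powr (n * (IY - 2 * d))\<close>, a factor \<open>2 powr (n * d)\<close> below
  \<open>\<eta>\<close>, and \<open>B * J\<close> is then larger than \<open>\<gamma>\<close> by a
  factor of the same order. The divisor 4 in the hypothesis leaves room for rounding down two
  message sets.\<close>

lemma block_code:
  assumes R: "IX - IY < R" and \<epsilon>: "\<epsilon> > 0"
  shows "\<exists>N. \<forall>n\<ge>N. \<forall>B. real B \<ge> 2 powr (real n * R) / 4 \<longrightarrow>
    (\<exists>(enc :: (nat \<Rightarrow> 'x) \<Rightarrow> nat) (dc :: nat \<Rightarrow> (nat \<Rightarrow> 'y) \<Rightarrow> (nat \<Rightarrow> 'v)). (\<forall>xs. enc xs < B) \<and>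
      (\<Sum>xs\<in>seqs n. \<Sum>ys\<in>seqs n. block_p n xs ys * of_bool (\<not> block_Q n xs (dc (enc xs) ys) > 0)) \<le> \<epsilon>)"
proof -
  define d where "d = (R - (IX - IY)) / 4"
  have d: "d > 0" and Rd: "R = IX - IY + 4 * d" using R by (auto simp: d_def field_simps)
  obtain r1 where r1: "0 \<le> r1" "r1 < 1" and r1_le: "\<And>n. (\<Sum>vs\<in>seqs n. \<Sum>ys\<in>seqs n. block.PVY n vs ys *
       of_bool (2 powr (real n * (IY - d)) * block.PV n vs * block.PY n ys > block.PVY n vs ys)) \<le> r1 ^ n"
    using typical_side_information[OF d] by blast
  obtain r2 where r2: "0 \<le> r2" "r2 < 1" and r2_le: "\<And>n. (\<Sum>xs\<in>seqs n. \<Sum>vs\<in>seqs n. block.PX n xs * block_Q n xs vs *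
       of_bool (block_Q n xs vs > 2 powr (real n * (IX + d)) * block.PV n vs)) \<le> r2 ^ n"
    using typical_test_channel[OF d] by blast
  define \<rho> where "\<rho> = 2 powr (- d)"
  have \<rho>: "0 \<le> \<rho>" "\<rho> < 1" using d by (auto simp: \<rho>_def powr_less_one)
  have \<rho>n: "2 powr (- (real n * d)) = \<rho> ^ n" for n
    by (simp add: \<rho>_def powr_realpow[symmetric] powr_powr mult.commute)
  \<comment> \<open>These are the terms of \<open>exists_code\<close> for
    \<open>\<delta> = \<epsilon> / 2\<close>. The factor 8 is the product of the rounding losses 4
    for \<open>B\<close> and 2 for \<open>J\<close>.\<close>
  have "(\<lambda>n. r1 ^ n + \<rho> ^ n + r2 ^ n + \<epsilon> / 4 + 8 / \<epsilon> * \<rho> ^ n) \<longlonglongrightarrow> 0 + 0 + 0 + \<epsilon> / 4 + 8 / \<epsilon> * 0"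
    using r1 r2 \<rho> by (intro tendsto_intros LIMSEQ_power_zero) auto
  then have "\<forall>\<^sub>F n in sequentially. r1 ^ n + \<rho> ^ n + r2 ^ n + \<epsilon> / 4 + 8 / \<epsilon> * \<rho> ^ n < \<epsilon>"
    by (rule order_tendstoD) (use \<epsilon> in simp)
  then obtain N where N: "\<And>n. n \<ge> N \<Longrightarrow> r1 ^ n + \<rho> ^ n + r2 ^ n + \<epsilon> / 4 + 8 / \<epsilon> * \<rho> ^ n < \<epsilon>"
    by (auto simp: eventually_sequentially)
  show ?thesis
  proof (intro exI[of _ N] allI impI)
    fix n B assume n: "N \<le> n" and B: "real B \<ge> 2 powr (real n * R) / 4"
    define \<gamma> where "\<gamma> = 2 powr (real n * (IX + d))"
    define \<eta> where "\<eta> = 2 powr (real n * (IY - d))"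
    define t where "t = 2 powr (real n * (IY - 2 * d))"
    \<comment> \<open>The maximum keeps the bins nonempty when \<open>IY - 2 * d\<close> is
      negative; both estimates for \<open>J\<close> below survive it.\<close>
    define J where "J = max 1 (nat \<lfloor>t\<rfloor>)"
    define \<delta> where "\<delta> = \<epsilon> / 2"
    have t: "t > 0" by (simp add: t_def)
    have J1: "real J - 1 \<le> t" and J2: "real J \<ge> t / 2"
      using t unfolding J_def by linarith+
    have "real B > 0" using B by (smt (verit) powr_gt_zero divide_pos_pos)
    then interpret random_code "seqs n" "seqs n" "seqs n" "block_p n" "block_Q n" B J \<gamma> \<eta> \<delta>
      by unfold_locales (use \<epsilon> in \<open>auto simp: J_def \<gamma>_def \<eta>_def \<delta>_def\<close>)
    have e1: "(real J - 1) / \<eta> \<le> \<rho> ^ n"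
    proof -
      have "(real J - 1) / \<eta> \<le> t / \<eta>" using J1 by (simp add: \<eta>_def divide_right_mono)
      also have "\<dots> = 2 powr (- (real n * d))"
        unfolding t_def \<eta>_def powr_diff[symmetric] by (simp add: algebra_simps)
      finally show ?thesis by (simp add: \<rho>n)
    qed
    have e2: "\<gamma> / (2 * \<delta> * (real B * real J)) \<le> 8 / \<epsilon> * \<rho> ^ n"
    proof -
      have "2 powr (real n * R) / 4 * (t / 2) \<le> real B * real J"
        using B J2 t by (intro mult_mono) auto
      moreover have "2 powr (real n * R) / 4 * (t / 2) = \<gamma> * 2 powr (real n * d) / 8"
        unfolding t_def \<gamma>_def Rd by (simp add: powr_add[symmetric] algebra_simps)
      ultimately have BJ': "\<gamma> * 2 powr (real n * d) / 8 \<le> real B * real J" by simp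
      have "\<gamma> / (2 * \<delta> * (real B * real J)) \<le> \<gamma> / (2 * \<delta> * (\<gamma> * 2 powr (real n * d) / 8))"
        using BJ' \<epsilon> by (intro divide_left_mono mult_left_mono mult_pos_pos) (auto simp: \<delta>_def \<gamma>_def BJ)
      also have "\<dots> = 8 / \<epsilon> * 2 powr (- (real n * d))"
        using \<epsilon> by (simp add: \<delta>_def \<gamma>_def powr_minus field_simps)
      finally show ?thesis by (simp add: \<rho>n)
    qed
    obtain enc :: "(nat \<Rightarrow> 'x) \<Rightarrow> nat" and dc :: "nat \<Rightarrow> (nat \<Rightarrow> 'y) \<Rightarrow> (nat \<Rightarrow> 'v)" where "\<forall>xs. enc xs < B"
      and le: "(\<Sum>xs\<in>seqs n. \<Sum>ys\<in>seqs n. block_p n xs ys * of_bool (\<not> block_Q n xs (dc (enc xs) ys) > 0))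
        \<le> (\<Sum>vs\<in>seqs n. \<Sum>ys\<in>seqs n. block.PVY n vs ys * of_bool (\<eta> * block.PV n vs * block.PY n ys > block.PVY n vs ys)) + (real J - 1) / \<eta>
       + (\<Sum>xs\<in>seqs n. \<Sum>vs\<in>seqs n. block.PX n xs * block_Q n xs vs * of_bool (block_Q n xs vs > \<gamma> * block.PV n vs))
       + \<delta> / 2 + \<gamma> / (2 * \<delta> * (real B * real J))"
      using exists_code by blast
    moreover have "\<dots> \<le> \<epsilon>"
      using r1_le[of n] r2_le[of n] e1 e2 N[OF n] \<epsilon> unfolding \<gamma>_def[symmetric] \<eta>_def[symmetric]
      by (simp add: \<delta>_def)
    ultimately show "\<exists>(enc :: (nat \<Rightarrow> 'x) \<Rightarrow> nat) (dc :: nat \<Rightarrow> (nat \<Rightarrow> 'y) \<Rightarrow> (nat \<Rightarrow> 'v)). (\<forall>xs. enc xs < B) \<and>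
      (\<Sum>xs\<in>seqs n. \<Sum>ys\<in>seqs n. block_p n xs ys * of_bool (\<not> block_Q n xs (dc (enc xs) ys) > 0)) \<le> \<epsilon>"
      by (blast intro: order_trans)
  qed
qed

text \<open>Since V - X - Y is Markov, the difference is the conditional mutual information of V and
  X given Y: \<open>PV\<close> cancels in each summand. The right side has the shape of
  \<open>cond_mutual_info\<close>.\<close>

lemma IX_minus_IY:
  "IX - IY = (\<Sum>v\<in>UNIV. \<Sum>x\<in>UNIV. \<Sum>y\<in>UNIV.
     if p x y * Q x v > 0 then p x y * Q x v * log 2 (p x y * Q x v * PY y / (PVY v y * p x y)) else 0)"
proof -
  have X: "IX = (\<Sum>v\<in>UNIV. \<Sum>x\<in>UNIV. \<Sum>y\<in>UNIV. p x y * Q x v * log 2 (Q x v / PV v))"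
    unfolding IX_def PX_def by (subst sum.swap) (simp add: sum_distrib_right)
  have "IY = (\<Sum>v\<in>UNIV. \<Sum>y\<in>UNIV. \<Sum>x\<in>UNIV. p x y * Q x v * log 2 (PVY v y / (PV v * PY y)))"
    unfolding IY_def by (subst PVY_def) (simp add: sum_distrib_right)
  also have "\<dots> = (\<Sum>v\<in>UNIV. \<Sum>x\<in>UNIV. \<Sum>y\<in>UNIV. p x y * Q x v * log 2 (PVY v y / (PV v * PY y)))"
    by (intro sum.cong refl sum.swap)
  finally have Y: "IY = \<dots>" .
  show ?thesis unfolding X Y sum_subtractf[symmetric]
  proof (intro sum.cong refl)
    fix v x y
    show "p x y * Q x v * log 2 (Q x v / PV v) - p x y * Q x v * log 2 (PVY v y / (PV v * PY y))
      = (if p x y * Q x v > 0 then p x y * Q x v * log 2 (p x y * Q x v * PY y / (PVY v y * p x y)) else 0)"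
    proof (cases "p x y * Q x v > 0")
      case True
      then have pos: "p x y > 0" "Q x v > 0" using p0[of x y] Q0[of x v] by (auto simp: zero_less_mult_iff)
      have "PVY v y > 0" using True PVY_pos_iff by blast
      with PVY_pos_imp[OF this] pos show ?thesis using True
        by (simp add: log_divide log_mult right_diff_distrib[symmetric])
    next
      case False
      then have "p x y * Q x v = 0" using p0[of x y] Q0[of x v] by (simp add: less_le)
      then show ?thesis by auto
    qed
  qed
qed

end

section \<open>Achievability\<close>

lemma pmf_map_snd: "pmf (map_pmf snd p) y = (\<Sum>x\<in>UNIV. pmf p (x, y))"
  for p :: "('x::finite \<times> 'y::finite) pmf"
proof -
  have "snd -` {y} = (\<lambda>x::'x. (x, y)) ` UNIV" by auto
  then show ?thesis
    by (simp add: pmf_map measure_measure_pmf_finite sum.reindex inj_on_def)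
qed

lemma pmf_map_fst: "pmf (map_pmf fst p) x = (\<Sum>y\<in>UNIV. pmf p (x, y))"
  for p :: "('x::finite \<times> 'y::finite) pmf"
proof -
  have "fst -` {x} = (\<lambda>y::'y. (x, y)) ` UNIV" by auto
  then show ?thesis
    by (simp add: pmf_map measure_measure_pmf_finite sum.reindex inj_on_def)
qed

lemma sum_pmf_UNIV: "(\<Sum>a\<in>UNIV. pmf q a) = 1" for q :: "'a::finite pmf"
  by (rule sum_pmf_eq_1) auto

lemma sum_pmf_pair: "(\<Sum>x\<in>UNIV. \<Sum>y\<in>UNIV. pmf p (x, y)) = 1"
  for p :: "('x::finite \<times> 'y::finite) pmf"
  using sum_pmf_UNIV[of "map_pmf fst p"] by (simp add: pmf_map_fst)

lemma memoryless_source_pmf: "memoryless_source (\<lambda>x y. pmf p (x, y)) (\<lambda>x. pmf (Q x))"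
  for p :: "('x::finite \<times> 'y::finite) pmf" and Q :: "'x \<Rightarrow> 'v::finite pmf"
  by unfold_locales (auto simp: sum_pmf_UNIV sum_pmf_pair)

lemma cond_mutual_info_eq:
  "cond_mutual_info p Q =
     memoryless_source.IX (\<lambda>x y. pmf p (x, y)) (\<lambda>x. pmf (Q x)) - memoryless_source.IY (\<lambda>x y. pmf p (x, y)) (\<lambda>x. pmf (Q x))"
proof -
  interpret memoryless_source "\<lambda>x y. pmf p (x, y)" "\<lambda>x. pmf (Q x)" by (rule memoryless_source_pmf)
  show ?thesis
    unfolding IX_minus_IY cond_mutual_info_def Let_def PY_def PVY_def pmf_map_snd by (rule refl)
qed

lemma entropy_pmf_map_snd:
  "entropy_pmf (map_pmf snd p) = (\<Sum>x\<in>UNIV. \<Sum>y\<in>UNIV. pmf p (x, y) * log 2 (1 / pmf (map_pmf snd p) y))"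
  for p :: "('x::finite \<times> 'y::finite) pmf"
proof -
  have "(\<Sum>x\<in>UNIV. \<Sum>y\<in>UNIV. pmf p (x, y) * log 2 (1 / pmf (map_pmf snd p) y))
      = (\<Sum>y\<in>UNIV. pmf (map_pmf snd p) y * log 2 (1 / pmf (map_pmf snd p) y))"
    by (subst sum.swap) (simp add: pmf_map_snd flip: sum_distrib_right)
  also have "\<dots> = entropy_pmf (map_pmf snd p)"
    unfolding entropy_pmf_def sum_negf[symmetric]
  proof (intro sum.cong refl)
    fix y
    show "pmf (map_pmf snd p) y * log 2 (1 / pmf (map_pmf snd p) y) =
      - (if 0 < pmf (map_pmf snd p) y then pmf (map_pmf snd p) y * log 2 (pmf (map_pmf snd p) y) else 0)"
      using log_inverse[of 2 "pmf (map_pmf snd p) y"] pmf_nonneg[of "map_pmf snd p" y]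
      by (auto simp: inverse_eq_divide less_le simp del: pmf_nonneg)
  qed
  finally show ?thesis by simp
qed

lemma entropy_pmf_nonneg: "entropy_pmf q \<ge> 0"
proof -
  have "pmf q a * log 2 (pmf q a) \<le> 0" if "pmf q a > 0" for a
    using that pmf_le_1[of q a] by (intro mult_nonneg_nonpos) auto
  then show ?thesis unfolding entropy_pmf_def by (auto intro!: sum_nonpos)
qed

text \<open>\<open>A\<close> consists of the sequences of probability at least
  \<open>2 powr (- n * R)\<close>. As the probabilities sum to 1 there are at most
  \<open>2 powr (n * R)\<close> of them, and the rest is an upward deviation of the
  self-information, whose mean is the entropy. The sum over \<open>xs\<close> puts the error in the
  form in which it enters \<open>err_prob\<close>.\<close>

lemma lossless_source_code:
  fixes p :: "('x::finite \<times> 'y::finite) pmf"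
  assumes H: "entropy_pmf (map_pmf snd p) < R" and \<epsilon>: "\<epsilon> > 0"
  shows "\<exists>N. \<forall>n\<ge>N. \<exists>A \<subseteq> seqs n. real (card A) \<le> 2 powr (real n * R) \<and>
     (\<Sum>xs\<in>seqs n. \<Sum>ys\<in>seqs n. seq_prob p n xs ys * of_bool (ys \<notin> A)) \<le> \<epsilon>"
proof -
  define PY where "PY = pmf (map_pmf snd p)"
  have pos: "PY y > 0" if "pmf p (x, y) > 0" for x y
    unfolding PY_def pmf_map_snd using that by (intro sum_pos2[of _ x]) auto
  obtain r where r: "0 \<le> r" "r < 1" and r_le: "\<And>n. (\<Sum>xs\<in>seqs n. \<Sum>ys\<in>seqs n. (\<Prod>i<n. pmf p (xs i, ys i)) *
      of_bool ((\<Prod>i<n. 1) > 2 powr (real n * R) * (\<Prod>i<n. PY (ys i)))) \<le> r ^ n"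
    using likelihood_ratio_deviation[of "\<lambda>x y. pmf p (x, y)" "\<lambda>_ _. 1" "\<lambda>x y. PY y" R] H pos
    by (auto simp: sum_pmf_pair entropy_pmf_map_snd PY_def)
  have "(\<lambda>n. r ^ n) \<longlonglongrightarrow> 0" using r by (intro LIMSEQ_power_zero) auto
  then have "\<forall>\<^sub>F n in sequentially. r ^ n < \<epsilon>" by (rule order_tendstoD) (use \<epsilon> in simp)
  then obtain N where N: "\<And>n. n \<ge> N \<Longrightarrow> r ^ n < \<epsilon>" by (auto simp: eventually_sequentially)
  show ?thesis
  proof (intro exI[of _ N] allI impI)
    fix n assume n: "N \<le> n"
    define A where "A = {ys \<in> seqs n. 1 \<le> 2 powr (real n * R) * (\<Prod>i<n. PY (ys i))}"
    have nonneg: "0 \<le> (\<Prod>i<n. PY (ys i))" for ys by (intro prod_nonneg) (auto simp: PY_def)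
    have "real (card A) = (\<Sum>ys\<in>A. 1)" by simp
    also have "\<dots> \<le> (\<Sum>ys\<in>A. 2 powr (real n * R) * (\<Prod>i<n. PY (ys i)))"
      by (intro sum_mono) (auto simp: A_def)
    also have "\<dots> \<le> (\<Sum>ys\<in>seqs n. 2 powr (real n * R) * (\<Prod>i<n. PY (ys i)))"
      by (intro sum_mono2) (auto simp: A_def nonneg)
    also have "\<dots> = 2 powr (real n * R)"
      using sum_seqs_prod[of "\<lambda>_. PY" n] by (simp add: PY_def sum_pmf_UNIV flip: sum_distrib_left)
    finally have card: "real (card A) \<le> 2 powr (real n * R)" .
    have "(\<Sum>xs\<in>seqs n. \<Sum>ys\<in>seqs n. seq_prob p n xs ys * of_bool (ys \<notin> A))
      = (\<Sum>xs\<in>seqs n. \<Sum>ys\<in>seqs n. (\<Prod>i<n. pmf p (xs i, ys i)) *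
          of_bool ((\<Prod>i<n. 1) > 2 powr (real n * R) * (\<Prod>i<n. PY (ys i))))"
      by (intro sum.cong refl) (auto simp: seq_prob_def A_def)
    also have "\<dots> \<le> \<epsilon>" using r_le[of n] N[OF n] by linarith
    finally show "\<exists>A \<subseteq> seqs n. real (card A) \<le> 2 powr (real n * R) \<and>
     (\<Sum>xs\<in>seqs n. \<Sum>ys\<in>seqs n. seq_prob p n xs ys * of_bool (ys \<notin> A)) \<le> \<epsilon>"
      using card by (intro exI[of _ A]) (auto simp: A_def)
  qed
qed

section \<open>Message sets and construction of the code\<close>

lemma seq_prob_nonneg: "seq_prob p n xs ys \<ge> 0"
  unfolding seq_prob_def by (intro prod_nonneg) auto

lemma seq_prob_pos_iff: "seq_prob p n xs ys > 0 \<longleftrightarrow> (\<forall>i<n. pmf p (xs i, ys i) > 0)"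
  using seq_prob_nonneg[of p n xs ys] unfolding seq_prob_def
  by (auto simp: less_le intro!: prod_pos)

lemma real_msgs_le: "real (msgs n R) \<le> 2 powr (real n * R)"
  by (simp add: msgs_def of_nat_nat)

lemma msgs_ge_half:
  assumes "R \<ge> 0"
  shows "real (msgs n R) \<ge> 2 powr (real n * R) / 2" and "msgs n R \<ge> 1"
proof -
  define t where "t = 2 powr (real n * R)"
  have "t \<ge> 1" using assms by (simp add: t_def ge_one_powr_ge_zero)
  then have "real_of_int \<lfloor>t\<rfloor> \<ge> 1" by simp
  then show "real (msgs n R) \<ge> 2 powr (real n * R) / 2" and "msgs n R \<ge> 1"
    using floor_correct[of t] unfolding msgs_def t_def[symmetric] by linarith+
qed

text \<open>The bin index \<open>enc xs\<close> is written in base \<open>M\<close>: the low digit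
  travels through the encoder of Y, the high digit directly. The encoder of Y appends its digit to
  the number of \<open>ys\<close> in \<open>A\<close>, so the decoder recovers both
  \<open>ys\<close> and the bin index.\<close>

lemma good_codeI:
  fixes p :: "('x::finite \<times> 'y::finite) pmf" and f :: "'x \<Rightarrow> 'y \<Rightarrow> 'f" and Q :: "'x \<Rightarrow> 'x set pmf"
    and enc :: "(nat \<Rightarrow> 'x) \<Rightarrow> nat"
  assumes adm: "admissible_V p f Q"
    and R: "R0 \<ge> 0" "RX \<ge> 0" "RY \<ge> 0"
    and A: "A \<subseteq> seqs n" "card A * msgs n R0 \<le> msgs n RY"
      "(\<Sum>xs\<in>seqs n. \<Sum>ys\<in>seqs n. seq_prob p n xs ys * of_bool (ys \<notin> A)) \<le> \<epsilon> / 2"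
    and enc: "\<And>xs. enc xs < msgs n R0 * msgs n RX"
    and dec: "(\<Sum>xs\<in>seqs n. \<Sum>ys\<in>seqs n. seq_prob p n xs ys *
       of_bool (\<not> (\<Prod>i<n. pmf (Q (xs i)) (dc (enc xs) ys i)) > 0)) \<le> \<epsilon> / 2"
  shows "good_code p f n R0 RX RY \<epsilon>"
proof -
  define M where "M = msgs n R0"
  have M: "M \<ge> 1" unfolding M_def using msgs_ge_half R by blast
  have finA: "finite A" using A(1) finite_seqs by (rule finite_subset)
  obtain g where g: "bij_betw g A {..<card A}"
    using ex_bij_betw_finite_nat[OF finA] by (auto simp: atLeast0LessThan)
  \<comment> \<open>On an independent set \<open>v\<close>, all \<open>x\<close> of \<open>v\<close>
    with \<open>p(x,y) > 0\<close> give the same value \<open>f x y\<close>, so any such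
    \<open>x\<close> will do.\<close>
  define F where "F v y = f (SOME x. x \<in> v \<and> pmf p (x, y) > 0) y" for v y
  define \<phi>0 where "\<phi>0 xs = Suc (enc xs mod M)" for xs
  define \<phi>X where "\<phi>X xs = Suc (enc xs div M)" for xs
  \<comment> \<open>Messages start at 1 and \<open>m\<close> runs through \<open>1..M\<close>, so 1
    is subtracted before \<open>div\<close> and \<open>mod\<close> when decoding. The message 1 for
    \<open>ys\<close> outside \<open>A\<close> is a default; such blocks count as errors.\<close>
  define \<phi>Y where "\<phi>Y ys m = (if ys \<in> A then g ys * M + m else 1)" for ys m
  define \<psi> where "\<psi> mX mY = (let ys = inv_into A g ((mY - 1) div M) in
     (\<lambda>i. F (dc ((mX - 1) * M + (mY - 1) mod M) ys i) (ys i)))" for mX mY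
  have r0: "\<phi>0 xs \<in> {1..msgs n R0}" for xs
    using M by (simp add: \<phi>0_def Suc_le_eq flip: M_def)
  have rX: "\<phi>X xs \<in> {1..msgs n RX}" for xs
    using enc[of xs] M by (simp add: \<phi>X_def Suc_le_eq div_less_iff_less_mult mult.commute flip: M_def)
  have rY: "\<phi>Y ys m \<in> {1..msgs n RY}" if "m \<in> {1..msgs n R0}" for ys m
  proof (cases "ys \<in> A")
    case True
    then have "g ys < card A" using g by (auto simp: bij_betw_def)
    then have "(g ys + 1) * M \<le> card A * M" by (intro mult_le_mono1) simp
    then show ?thesis using True A(2) that by (auto simp: \<phi>Y_def M_def)
  next
    case False
    then show ?thesis using msgs_ge_half(2)[OF R(3), of n] by (simp add: \<phi>Y_def)
  qed
  have correct: "\<psi> (\<phi>X xs) (\<phi>Y ys (\<phi>0 xs)) i = f (xs i) (ys i)"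
    if ys: "ys \<in> A" and p: "seq_prob p n xs ys > 0" and q: "(\<Prod>i<n. pmf (Q (xs i)) (dc (enc xs) ys i)) > 0"
      and i: "i < n" for xs ys i
  proof -
    have "inv_into A g ((\<phi>Y ys (\<phi>0 xs) - 1) div M) = ys"
      using g ys M by (simp add: \<phi>Y_def \<phi>0_def bij_betw_def)
    moreover have "(\<phi>X xs - 1) * M + (\<phi>Y ys (\<phi>0 xs) - 1) mod M = enc xs"
      using ys by (simp add: \<phi>Y_def \<phi>0_def \<phi>X_def)
    ultimately have \<psi>: "\<psi> (\<phi>X xs) (\<phi>Y ys (\<phi>0 xs)) i = F (dc (enc xs) ys i) (ys i)"
      by (simp add: \<psi>_def)
    define v where "v = dc (enc xs) ys i"
    have pp: "pmf p (xs i, ys i) > 0" using p i by (simp add: seq_prob_pos_iff)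
    have qq: "pmf (Q (xs i)) v > 0"
    proof -
      have "pmf (Q (xs i)) v \<noteq> 0" using q i prod_zero[of "{..<n}" "\<lambda>i. pmf (Q (xs i)) (dc (enc xs) ys i)"]
        unfolding v_def by (metis finite_lessThan lessThan_iff less_irrefl)
      then show ?thesis by (simp add: less_le)
    qed
    have "pmf (map_pmf fst p) (xs i) > 0"
      unfolding pmf_map_fst using pp by (intro sum_pos2[of _ "ys i"]) auto
    then have "pmf (map_pmf fst p) (xs i) * pmf (Q (xs i)) v > 0" using qq by simp
    then have v: "indep_set p f v" "xs i \<in> v"
      using adm unfolding admissible_V_def by blast+
    define x where "x = (SOME x. x \<in> v \<and> pmf p (x, ys i) > 0)"
    have x: "x \<in> v \<and> pmf p (x, ys i) > 0"
      unfolding x_def by (rule someI[of _ "xs i"]) (use v pp in simp)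
    then have "\<not> char_adj p f x (xs i)" using v by (simp add: indep_set_def)
    moreover have "pmf p (x, ys i) * pmf p (xs i, ys i) > 0" using x pp by simp
    ultimately have "f x (ys i) = f (xs i) (ys i)" unfolding char_adj_def by blast
    then show ?thesis unfolding \<psi> F_def v_def[symmetric] x_def[symmetric] .
  qed
  have "err_prob p f n \<phi>0 \<phi>X \<phi>Y \<psi> \<le> (\<Sum>xs\<in>seqs n. \<Sum>ys\<in>seqs n. seq_prob p n xs ys * of_bool (ys \<notin> A)
     + seq_prob p n xs ys * of_bool (\<not> (\<Prod>i<n. pmf (Q (xs i)) (dc (enc xs) ys i)) > 0))"
    unfolding err_prob_def sum.cartesian_product
  proof (intro sum_mono, clarify)
    fix xs ys
    show "seq_prob p n xs ys * (if \<exists>i<n. \<psi> (\<phi>X xs) (\<phi>Y ys (\<phi>0 xs)) i \<noteq> f (xs i) (ys i) then 1 else 0)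
      \<le> seq_prob p n xs ys * of_bool (ys \<notin> A)
     + seq_prob p n xs ys * of_bool (\<not> (\<Prod>i<n. pmf (Q (xs i)) (dc (enc xs) ys i)) > 0)"
      using correct[of ys xs] seq_prob_nonneg[of p n xs ys]
      by (cases "seq_prob p n xs ys = 0") (auto simp: less_le)
  qed
  also have "\<dots> \<le> \<epsilon>" using A(3) dec by (simp only: sum.distrib)
  finally show ?thesis unfolding good_code_def using r0 rX rY by blast
qed

text \<open>The bin index uses the product of the two message sets of X, of total rate
  \<open>R0 + RX\<close>. The relayed digit takes \<open>R0\<close> of the rate of Y, and the
  remaining \<open>RY - R0\<close> exceeds the entropy of Y.\<close>

lemma achievable_above_cond_mutual_info:
  fixes p :: "('x::finite \<times> 'y::finite) pmf" and f :: "'x \<Rightarrow> 'y \<Rightarrow> 'f"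
  assumes adm: "admissible_V p f Q" and I: "cond_mutual_info p Q < R0 + RX"
    and R: "R0 \<ge> 0" "RX \<ge> 0" and RY: "R0 + entropy_pmf (map_pmf snd p) < RY"
  shows "achievable p f (R0, RX, RY)"
  unfolding achievable_def prod.case
proof (intro allI impI)
  fix \<epsilon> :: real assume \<epsilon>: "\<epsilon> > 0"
  interpret memoryless_source "\<lambda>x y. pmf p (x, y)" "\<lambda>x. pmf (Q x)" by (rule memoryless_source_pmf)
  have RY0: "RY \<ge> 0" using RY R entropy_pmf_nonneg[of "map_pmf snd p"] by linarith
  have "IX - IY < R0 + RX" using I by (simp add: cond_mutual_info_eq)
  from block_code[OF this half_gt_zero[OF \<epsilon>]] obtain N1 where N1: "\<And>n B. n \<ge> N1 \<Longrightarrow> real B \<ge> 2 powr (real n * (R0 + RX)) / 4 \<Longrightarrow>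
    (\<exists>(enc :: (nat \<Rightarrow> 'x) \<Rightarrow> nat) (dc :: nat \<Rightarrow> (nat \<Rightarrow> 'y) \<Rightarrow> (nat \<Rightarrow> 'x set)). (\<forall>xs. enc xs < B) \<and>
      (\<Sum>xs\<in>seqs n. \<Sum>ys\<in>seqs n. block_p n xs ys * of_bool (\<not> block_Q n xs (dc (enc xs) ys) > 0)) \<le> \<epsilon> / 2)"
    by blast
  have "entropy_pmf (map_pmf snd p) < RY - R0" using RY by simp
  from lossless_source_code[OF this half_gt_zero[OF \<epsilon>]] obtain N2 where N2: "\<And>n. n \<ge> N2 \<Longrightarrow> \<exists>A \<subseteq> seqs n. real (card A) \<le> 2 powr (real n * (RY - R0)) \<and>
     (\<Sum>xs\<in>seqs n. \<Sum>ys\<in>seqs n. seq_prob p n xs ys * of_bool (ys \<notin> A)) \<le> \<epsilon> / 2"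
    by blast
  show "\<exists>N. \<forall>n\<ge>N. good_code p f n R0 RX RY \<epsilon>"
  proof (intro exI[of _ "max N1 N2"] allI impI)
    fix n assume "max N1 N2 \<le> n"
    then have n: "n \<ge> N1" "n \<ge> N2" by auto
    \<comment> \<open>For nonnegative rates each floor in \<open>msgs\<close> loses at most a factor
      2.\<close>
    have "2 powr (real n * (R0 + RX)) / 4 = (2 powr (real n * R0) / 2) * (2 powr (real n * RX) / 2)"
      by (simp add: powr_add distrib_left)
    also have "\<dots> \<le> real (msgs n R0) * real (msgs n RX)"
      using msgs_ge_half R by (intro mult_mono) auto
    finally have "2 powr (real n * (R0 + RX)) / 4 \<le> real (msgs n R0 * msgs n RX)" by simp
    from N1[OF n(1) this] obtain enc :: "(nat \<Rightarrow> 'x) \<Rightarrow> nat" and dc :: "nat \<Rightarrow> (nat \<Rightarrow> 'y) \<Rightarrow> (nat \<Rightarrow> 'x set)"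
      where enc: "\<And>xs. enc xs < msgs n R0 * msgs n RX"
       and dc: "(\<Sum>xs\<in>seqs n. \<Sum>ys\<in>seqs n. block_p n xs ys * of_bool (\<not> block_Q n xs (dc (enc xs) ys) > 0)) \<le> \<epsilon> / 2"
      by blast
    from N2[OF n(2)] obtain A where A: "A \<subseteq> seqs n" "real (card A) \<le> 2 powr (real n * (RY - R0))"
      "(\<Sum>xs\<in>seqs n. \<Sum>ys\<in>seqs n. seq_prob p n xs ys * of_bool (ys \<notin> A)) \<le> \<epsilon> / 2" by blast
    have "real (card A * msgs n R0) \<le> 2 powr (real n * (RY - R0)) * 2 powr (real n * R0)"
      unfolding of_nat_mult using A(2) real_msgs_le by (intro mult_mono) auto
    also have "\<dots> = 2 powr (real n * RY)" by (simp add: powr_add[symmetric] algebra_simps)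
    finally have "card A * msgs n R0 \<le> msgs n RY"
      unfolding msgs_def[of n RY] by (simp add: le_nat_floor)
    then show "good_code p f n R0 RX RY \<epsilon>"
      using good_codeI[where enc = enc and dc = dc, OF adm R RY0 A(1) _ A(3) enc] dc
      unfolding block_p_def block_Q_def seq_prob_def by blast
  qed
qed

section \<open>Gibbs' inequality\<close>

definition prb :: "'o set \<Rightarrow> ('o \<Rightarrow> real) \<Rightarrow> ('o \<Rightarrow> 'a) \<Rightarrow> 'a \<Rightarrow> real" where
  "prb \<Omega> w X a = (\<Sum>\<omega>\<in>\<Omega>. w \<omega> * of_bool (X \<omega> = a))"

text \<open>Shannon entropy in bits, as an expectation over outcomes. In this form the values of
  \<open>X\<close> may lie in an infinite type, such as one of sequences.\<close>

definition ent :: "'o set \<Rightarrow> ('o \<Rightarrow> real) \<Rightarrow> ('o \<Rightarrow> 'a) \<Rightarrow> real" where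
  "ent \<Omega> w X = (\<Sum>\<omega>\<in>\<Omega>. w \<omega> * log 2 (1 / prb \<Omega> w X (X \<omega>)))"

lemma ent_cong:
  assumes "\<And>\<omega> \<omega>'. \<omega> \<in> \<Omega> \<Longrightarrow> \<omega>' \<in> \<Omega> \<Longrightarrow> X \<omega> = X \<omega>' \<longleftrightarrow> Y \<omega> = Y \<omega>'"
  shows "ent \<Omega> w X = ent \<Omega> w Y"
  unfolding ent_def prb_def using assms by (auto intro!: sum.cong arg_cong2[where f = "(*)"])

locale finite_prob =
  fixes \<Omega> :: "'o set" and w :: "'o \<Rightarrow> real"
  assumes fin: "finite \<Omega>" and w0: "\<And>\<omega>. w \<omega> \<ge> 0" and w1: "sum w \<Omega> = 1"
begin

lemma prb0: "prb \<Omega> w X a \<ge> 0"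
  unfolding prb_def by (intro sum_nonneg) (simp add: w0)

lemma prb_pos: "\<omega> \<in> \<Omega> \<Longrightarrow> w \<omega> > 0 \<Longrightarrow> prb \<Omega> w X (X \<omega>) > 0"
  unfolding prb_def using fin w0 by (intro sum_pos2[of _ \<omega>]) auto

lemma prb_pos_imp: "prb \<Omega> w X a > 0 \<Longrightarrow> \<exists>\<omega>\<in>\<Omega>. w \<omega> > 0 \<and> X \<omega> = a"
proof (rule ccontr)
  assume "prb \<Omega> w X a > 0" and "\<not> (\<exists>\<omega>\<in>\<Omega>. w \<omega> > 0 \<and> X \<omega> = a)"
  then have "w \<omega> * of_bool (X \<omega> = a) = 0" if "\<omega> \<in> \<Omega>" for \<omega>
    using that w0[of \<omega>] by (auto simp: less_le)
  then have "prb \<Omega> w X a = 0" unfolding prb_def by (rule sum.neutral[OF ballI])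
  then show False using \<open>prb \<Omega> w X a > 0\<close> by simp
qed

lemma sum_eq_sum_prb:
  assumes "finite S" "X ` \<Omega> \<subseteq> S"
  shows "(\<Sum>\<omega>\<in>\<Omega>. w \<omega> * F (X \<omega>)) = (\<Sum>a\<in>S. prb \<Omega> w X a * F a)"
proof -
  have "(\<Sum>a\<in>S. prb \<Omega> w X a * F a) = (\<Sum>\<omega>\<in>\<Omega>. \<Sum>a\<in>S. w \<omega> * (of_bool (X \<omega> = a) * F a))"
    unfolding prb_def sum_distrib_right by (subst sum.swap) (simp add: mult.assoc)
  also have "\<dots> = (\<Sum>\<omega>\<in>\<Omega>. w \<omega> * F (X \<omega>))"
  proof (intro sum.cong refl)
    fix \<omega> assume "\<omega> \<in> \<Omega>"
    then have "X \<omega> \<in> S" using assms by auto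
    have "(\<Sum>a\<in>S. w \<omega> * (of_bool (X \<omega> = a) * F a)) = (\<Sum>a\<in>S. if X \<omega> = a then w \<omega> * F a else 0)"
      by (intro sum.cong) auto
    also have "\<dots> = w \<omega> * F (X \<omega>)" using assms \<open>X \<omega> \<in> S\<close> by simp
    finally show "(\<Sum>a\<in>S. w \<omega> * (of_bool (X \<omega> = a) * F a)) = w \<omega> * F (X \<omega>)" .
  qed
  finally show ?thesis by simp
qed

lemma sum_prb_eq_1: "finite S \<Longrightarrow> X ` \<Omega> \<subseteq> S \<Longrightarrow> (\<Sum>a\<in>S. prb \<Omega> w X a) = 1"
  using sum_eq_sum_prb[of S X "\<lambda>_. 1"] w1 by simp

lemma prb_fst: "prb \<Omega> w X a = (\<Sum>b\<in>UNIV. prb \<Omega> w (\<lambda>\<omega>. (X \<omega>, Y \<omega>)) (a, b))"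
  for Y :: "'o \<Rightarrow> 'b::finite"
proof -
  have "(\<Sum>b\<in>UNIV. w \<omega> * of_bool ((X \<omega>, Y \<omega>) = (a, b))) = w \<omega> * of_bool (X \<omega> = a)" for \<omega>
  proof -
    have "(\<Sum>b\<in>UNIV. w \<omega> * of_bool ((X \<omega>, Y \<omega>) = (a, b))) = (\<Sum>b\<in>UNIV. if Y \<omega> = b then w \<omega> * of_bool (X \<omega> = a) else 0)"
      by (intro sum.cong) auto
    then show ?thesis by simp
  qed
  then show ?thesis unfolding prb_def by (subst sum.swap) (simp only:)
qed

text \<open>Nonnegativity of relative entropy, from \<open>ln t \<le> t - 1\<close>. The reference
  \<open>h\<close> may have total mass below 1, which allows reference laws with terms
  dropped.\<close>

lemma gibbs_inequality:
  assumes S: "finite S" "X ` \<Omega> \<subseteq> S" and h0: "\<And>a. a \<in> S \<Longrightarrow> h a \<ge> 0" and h1: "sum h S \<le> 1"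
    and pos: "\<And>\<omega>. \<omega> \<in> \<Omega> \<Longrightarrow> w \<omega> > 0 \<Longrightarrow> h (X \<omega>) > 0"
  shows "(\<Sum>\<omega>\<in>\<Omega>. w \<omega> * log 2 (h (X \<omega>) / prb \<Omega> w X (X \<omega>))) \<le> 0"
proof -
  define \<rho> where "\<rho> a = h a / prb \<Omega> w X a" for a
  have "w \<omega> * log 2 (\<rho> (X \<omega>)) \<le> w \<omega> * ((\<rho> (X \<omega>) - 1) / ln 2)" if "\<omega> \<in> \<Omega>" for \<omega>
  proof (cases "w \<omega> = 0")
    case False
    then have "w \<omega> > 0" using w0[of \<omega>] by simp
    then have "\<rho> (X \<omega>) > 0" unfolding \<rho>_def by (intro divide_pos_pos pos prb_pos that)
    then have "log 2 (\<rho> (X \<omega>)) \<le> (\<rho> (X \<omega>) - 1) / ln 2"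
      unfolding log_def by (intro divide_right_mono ln_le_minus_one) auto
    then show ?thesis by (intro mult_left_mono w0)
  qed simp
  then have "(\<Sum>\<omega>\<in>\<Omega>. w \<omega> * log 2 (\<rho> (X \<omega>))) \<le> (\<Sum>\<omega>\<in>\<Omega>. w \<omega> * ((\<rho> (X \<omega>) - 1) / ln 2))"
    by (rule sum_mono)
  also have "\<dots> = ((\<Sum>\<omega>\<in>\<Omega>. w \<omega> * \<rho> (X \<omega>)) - sum w \<Omega>) / ln 2"
    by (simp add: sum_divide_distrib sum_subtractf right_diff_distrib diff_divide_distrib)
  also have "(\<Sum>\<omega>\<in>\<Omega>. w \<omega> * \<rho> (X \<omega>)) = (\<Sum>a\<in>S. prb \<Omega> w X a * \<rho> a)"
    by (rule sum_eq_sum_prb[OF S])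
  also have "\<dots> \<le> sum h S"
    by (intro sum_mono) (auto simp: \<rho>_def h0)
  finally show ?thesis using h1 w1 unfolding \<rho>_def
    by (smt (verit) divide_nonpos_pos divide_right_mono ln_gt_zero)
qed

text \<open>Replacing the auxiliary variable \<open>Z\<close> by \<open>G Z X\<close>, which rarely differs from \<open>D Z\<close>, hardly
  increases the information about \<open>X\<close>: Gibbs' inequality with the reference law that perturbs the
  point mass at \<open>D Z\<close> by the uniform law with weight \<open>\<theta>\<close>.\<close>
lemma information_perturbation:
  fixes Z :: "'o \<Rightarrow> 'z" and X :: "'o \<Rightarrow> 'x::finite" and Y :: "'z \<Rightarrow> 'y"
    and G :: "'z \<Rightarrow> 'x \<Rightarrow> 'v::finite" and D :: "'z \<Rightarrow> 'v"
  assumes \<theta>: "0 < \<theta>" "\<theta> < 1"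
  defines "V \<equiv> \<lambda>\<omega>. G (Z \<omega>) (X \<omega>)"
  assumes bad: "(\<Sum>\<omega>\<in>\<Omega>. w \<omega> * of_bool (V \<omega> \<noteq> D (Z \<omega>))) \<le> \<epsilon>"
  shows "(\<Sum>\<omega>\<in>\<Omega>. w \<omega> * log 2 (prb \<Omega> w (\<lambda>\<omega>. ((V \<omega>, Y (Z \<omega>)), X \<omega>)) ((V \<omega>, Y (Z \<omega>)), X \<omega>)
        / prb \<Omega> w (\<lambda>\<omega>. (V \<omega>, Y (Z \<omega>))) (V \<omega>, Y (Z \<omega>))))
    \<le> ent \<Omega> w Z - ent \<Omega> w (\<lambda>\<omega>. (Z \<omega>, X \<omega>)) + (- log 2 (1 - \<theta>) + \<epsilon> * log 2 (CARD('v) / \<theta>))"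
proof -
  define N where "N = real CARD('v)"
  have N: "N \<ge> 1" by (simp add: N_def Suc_le_eq)
  \<comment> \<open>The uniform part keeps the logarithm finite where \<open>V\<close> differs from
    \<open>D Z\<close>, at cost \<open>log 2 (N / \<theta>)\<close>; elsewhere the cost is at most
    \<open>- log 2 (1 - \<theta>)\<close>.\<close>
  define r where "r v z = (1 - \<theta>) * of_bool (v = D z) + \<theta> / N" for v z
  have r: "r v z > 0" for v z unfolding r_def using \<theta> N by (intro add_nonneg_pos) auto
  have r1: "(\<Sum>v\<in>UNIV. r v z) = 1" for z
  proof -
    have "(\<Sum>v\<in>UNIV. (1 - \<theta>) * of_bool (v = D z)) = (\<Sum>v\<in>UNIV. if D z = v then 1 - \<theta> else 0)"
      by (intro sum.cong) auto
    then show ?thesis using N unfolding r_def sum.distrib by (simp add: N_def)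
  qed
  define A where "A = prb \<Omega> w (\<lambda>\<omega>. ((V \<omega>, Y (Z \<omega>)), X \<omega>))"
  define B where "B = prb \<Omega> w (\<lambda>\<omega>. (V \<omega>, Y (Z \<omega>)))"
  define PZ where "PZ = prb \<Omega> w Z"
  define PZX where "PZX = prb \<Omega> w (\<lambda>\<omega>. (Z \<omega>, X \<omega>))"
  have nn: "A a \<ge> 0" "B b \<ge> 0" "PZ z \<ge> 0" for a b z by (simp_all add: A_def B_def PZ_def prb0)
  have AB: "(\<Sum>x\<in>UNIV. A ((v, y), x)) = B (v, y)" for v y
    unfolding A_def B_def by (rule prb_fst[symmetric])
  \<comment> \<open>A reference for the law of \<open>(Z, X)\<close>: draw \<open>z\<close> from its
    own law, then \<open>v\<close> from \<open>r\<close>, then \<open>x\<close> from the law of X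
    given \<open>v\<close> and \<open>Y z\<close>, and keep only the outcome
    \<open>v = G z x\<close>. Restoring the dropped \<open>v\<close> lets the sum over
    \<open>x\<close> collapse, so the total mass is at most 1.\<close>
  define h where "h = (\<lambda>(z, x). A ((G z x, Y z), x) * PZ z * r (G z x) z / B (G z x, Y z))"
  have h0: "h a \<ge> 0" for a
    unfolding h_def using nn r by (auto simp: less_imp_le intro!: divide_nonneg_nonneg mult_nonneg_nonneg split: prod.split)
  have row: "(\<Sum>x\<in>UNIV. h (z, x)) \<le> PZ z" for z
  proof -
    have "(\<Sum>x\<in>UNIV. h (z, x)) \<le> (\<Sum>x\<in>UNIV. \<Sum>v\<in>UNIV. A ((v, Y z), x) * PZ z * r v z / B (v, Y z))"
      unfolding h_def prod.case using nn r
      by (intro sum_mono member_le_sum) (auto simp: less_imp_le)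
    also have "\<dots> = (\<Sum>v\<in>UNIV. \<Sum>x\<in>UNIV. A ((v, Y z), x) * (PZ z * r v z / B (v, Y z)))"
      by (subst sum.swap) (simp add: mult.assoc)
    also have "\<dots> = (\<Sum>v\<in>UNIV. B (v, Y z) * (PZ z * r v z / B (v, Y z)))"
      by (simp only: sum_distrib_right[symmetric] AB)
    also have "\<dots> \<le> (\<Sum>v\<in>UNIV. PZ z * r v z)"
      using nn r by (intro sum_mono) (auto simp: less_imp_le)
    also have "\<dots> = PZ z" by (simp add: r1 flip: sum_distrib_left)
    finally show ?thesis .
  qed
  have "sum h (Z ` \<Omega> \<times> UNIV) = (\<Sum>z\<in>Z ` \<Omega>. \<Sum>x\<in>UNIV. h (z, x))"
    by (simp add: sum.cartesian_product)
  also have "\<dots> \<le> (\<Sum>z\<in>Z ` \<Omega>. PZ z)" by (intro sum_mono row)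
  also have "\<dots> = 1" unfolding PZ_def using fin by (intro sum_prb_eq_1) auto
  finally have h1: "sum h (Z ` \<Omega> \<times> UNIV) \<le> 1" .
  have posA: "A ((V \<omega>, Y (Z \<omega>)), X \<omega>) > 0" and posB: "B (V \<omega>, Y (Z \<omega>)) > 0"
    and posZ: "PZ (Z \<omega>) > 0" and posZX: "PZX (Z \<omega>, X \<omega>) > 0" if "\<omega> \<in> \<Omega>" "w \<omega> > 0" for \<omega>
    unfolding A_def B_def PZ_def PZX_def by (rule prb_pos[OF that])+
  have hV: "h (Z \<omega>, X \<omega>) = A ((V \<omega>, Y (Z \<omega>)), X \<omega>) * PZ (Z \<omega>) * r (V \<omega>) (Z \<omega>) / B (V \<omega>, Y (Z \<omega>))" for \<omega>
    by (simp add: h_def V_def)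
  have G: "(\<Sum>\<omega>\<in>\<Omega>. w \<omega> * log 2 (h (Z \<omega>, X \<omega>) / PZX (Z \<omega>, X \<omega>))) \<le> 0"
    unfolding PZX_def using fin h0 h1
    by (intro gibbs_inequality[where S = "Z ` \<Omega> \<times> UNIV"]) (auto simp: hV posA posB posZ r)
  \<comment> \<open>The logarithm splits into the information to be bounded, the two entropies and
    the cost of \<open>r\<close>.\<close>
  have split: "w \<omega> * log 2 (h (Z \<omega>, X \<omega>) / PZX (Z \<omega>, X \<omega>))
      = w \<omega> * log 2 (A ((V \<omega>, Y (Z \<omega>)), X \<omega>) / B (V \<omega>, Y (Z \<omega>))) + w \<omega> * log 2 (1 / PZX (Z \<omega>, X \<omega>))
        - w \<omega> * log 2 (1 / PZ (Z \<omega>)) + w \<omega> * log 2 (r (V \<omega>) (Z \<omega>))" if "\<omega> \<in> \<Omega>" for \<omega>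
  proof (cases "w \<omega> = 0")
    case False
    then have "w \<omega> > 0" using w0[of \<omega>] by simp
    note pos = posA[OF that this] posB[OF that this] posZ[OF that this] posZX[OF that this] r[of "V \<omega>" "Z \<omega>"]
    then have "log 2 (h (Z \<omega>, X \<omega>) / PZX (Z \<omega>, X \<omega>))
      = log 2 (A ((V \<omega>, Y (Z \<omega>)), X \<omega>) / B (V \<omega>, Y (Z \<omega>))) + log 2 (1 / PZX (Z \<omega>, X \<omega>))
        - log 2 (1 / PZ (Z \<omega>)) + log 2 (r (V \<omega>) (Z \<omega>))"
      unfolding hV by (simp add: log_divide_pos log_mult_pos)
    then show ?thesis by (simp only: distrib_left right_diff_distrib)
  qed simp
  have "- (w \<omega> * log 2 (r (V \<omega>) (Z \<omega>))) \<le> w \<omega> * - log 2 (1 - \<theta>) + w \<omega> * of_bool (V \<omega> \<noteq> D (Z \<omega>)) * log 2 (N / \<theta>)" for \<omega>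
  proof -
    have "- log 2 (r (V \<omega>) (Z \<omega>)) \<le> - log 2 (1 - \<theta>) + of_bool (V \<omega> \<noteq> D (Z \<omega>)) * log 2 (N / \<theta>)"
    proof (cases "V \<omega> = D (Z \<omega>)")
      case True
      have "1 - \<theta> \<le> r (V \<omega>) (Z \<omega>)" using True \<theta> N by (simp add: r_def)
      then have "log 2 (1 - \<theta>) \<le> log 2 (r (V \<omega>) (Z \<omega>))" using \<theta> by (subst log_le_cancel_iff) (auto simp: r)
      then show ?thesis using True by simp
    next
      case False
      have "log 2 (1 - \<theta>) \<le> 0" using \<theta> by simp
      moreover have "- log 2 (r (V \<omega>) (Z \<omega>)) = log 2 (N / \<theta>)"
        using False \<theta> N by (simp add: r_def log_divide_pos)
      ultimately show ?thesis using False by simp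
    qed
    from mult_left_mono[OF this w0[of \<omega>]] show ?thesis by (simp add: algebra_simps)
  qed
  then have "(\<Sum>\<omega>\<in>\<Omega>. - (w \<omega> * log 2 (r (V \<omega>) (Z \<omega>))))
      \<le> (\<Sum>\<omega>\<in>\<Omega>. w \<omega> * - log 2 (1 - \<theta>) + w \<omega> * of_bool (V \<omega> \<noteq> D (Z \<omega>)) * log 2 (N / \<theta>))"
    by (rule sum_mono)
  also have "\<dots> = - log 2 (1 - \<theta>) + (\<Sum>\<omega>\<in>\<Omega>. w \<omega> * of_bool (V \<omega> \<noteq> D (Z \<omega>))) * log 2 (N / \<theta>)"
    unfolding sum.distrib sum_distrib_right[symmetric] w1 by simp
  also have "\<dots> \<le> - log 2 (1 - \<theta>) + \<epsilon> * log 2 (N / \<theta>)"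
    using \<theta> N bad by (intro add_left_mono mult_right_mono) (auto simp: field_simps)
  finally have "(\<Sum>\<omega>\<in>\<Omega>. - (w \<omega> * log 2 (r (V \<omega>) (Z \<omega>)))) \<le> - log 2 (1 - \<theta>) + \<epsilon> * log 2 (N / \<theta>)" .
  moreover have "(\<Sum>\<omega>\<in>\<Omega>. w \<omega> * log 2 (h (Z \<omega>, X \<omega>) / PZX (Z \<omega>, X \<omega>)))
     = (\<Sum>\<omega>\<in>\<Omega>. w \<omega> * log 2 (A ((V \<omega>, Y (Z \<omega>)), X \<omega>) / B (V \<omega>, Y (Z \<omega>))))
       + ent \<Omega> w (\<lambda>\<omega>. (Z \<omega>, X \<omega>)) - ent \<Omega> w Z - (\<Sum>\<omega>\<in>\<Omega>. - (w \<omega> * log 2 (r (V \<omega>) (Z \<omega>))))"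
    unfolding ent_def PZ_def[symmetric] PZX_def[symmetric]
    by (simp only: split sum.distrib sum_subtractf sum_negf cong: sum.cong)
  ultimately show ?thesis using G unfolding A_def B_def N_def by linarith
qed

end

section \<open>Single-letter marginals of product laws\<close>

lemma seqs_upd: "ys \<in> seqs n \<Longrightarrow> i < n \<Longrightarrow> ys(i := y) \<in> seqs n"
  by (auto simp: seqs_def PiE_iff extensional_def)

lemma sum_seqs_fix_coord:
  fixes F :: "(nat \<Rightarrow> 'a::finite) \<Rightarrow> real"
  assumes "i < n"
  shows "(\<Sum>ys\<in>seqs n. of_bool (ys i = y) * F ys) = (\<Sum>ys\<in>seqs n. of_bool (ys i = y') * F (ys(i := y)))"
proof -
  have "(\<Sum>ys\<in>seqs n. of_bool (ys i = y) * F ys) = (\<Sum>ys\<in>{ys\<in>seqs n. ys i = y}. F ys)"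
    by (intro sum.mono_neutral_cong_right) auto
  also have "\<dots> = (\<Sum>ys\<in>{ys\<in>seqs n. ys i = y'}. F (ys(i := y)))"
    by (rule sum.reindex_bij_witness[of _ "\<lambda>ys. ys(i := y)" "\<lambda>ys. ys(i := y')"])
       (use assms in \<open>auto simp: seqs_upd\<close>)
  also have "\<dots> = (\<Sum>ys\<in>seqs n. of_bool (ys i = y') * F (ys(i := y)))"
    by (intro sum.mono_neutral_cong_left) auto
  finally show ?thesis .
qed

lemma sum_of_bool_eq: "(\<Sum>y\<in>UNIV. of_bool (a = y) * (c :: real)) = c" for a :: "'a::finite"
proof -
  have "(\<Sum>y\<in>UNIV. of_bool (a = y) * c) = (\<Sum>y\<in>UNIV. if a = y then c else 0)"
    by (intro sum.cong) auto
  then show ?thesis by simp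
qed

text \<open>Overwriting position \<open>i\<close> in all ways produces every sequence once for each
  symbol that may have stood there before.\<close>

lemma sum_seqs_resample:
  fixes F :: "(nat \<Rightarrow> 'a::finite) \<Rightarrow> real"
  assumes "i < n"
  shows "(\<Sum>y\<in>UNIV. \<Sum>ys\<in>seqs n. F (ys(i := y))) = real CARD('a) * (\<Sum>ys\<in>seqs n. F ys)"
proof -
  have "(\<Sum>ys\<in>seqs n. F (ys(i := y))) = real CARD('a) * (\<Sum>ys\<in>seqs n. of_bool (ys i = y) * F ys)" for y
  proof -
    have "(\<Sum>ys\<in>seqs n. F (ys(i := y))) = (\<Sum>ys\<in>seqs n. \<Sum>y'\<in>UNIV. of_bool (ys i = y') * F (ys(i := y)))"
      by (simp only: sum_of_bool_eq)
    also have "\<dots> = (\<Sum>y'\<in>UNIV. \<Sum>ys\<in>seqs n. of_bool (ys i = y') * F (ys(i := y)))"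
      by (rule sum.swap)
    also have "\<dots> = (\<Sum>y'\<in>(UNIV::'a set). \<Sum>ys\<in>seqs n. of_bool (ys i = y) * F ys)"
      by (intro sum.cong refl sum_seqs_fix_coord[OF assms, symmetric])
    finally show ?thesis by simp
  qed
  then have "(\<Sum>y\<in>UNIV. \<Sum>ys\<in>seqs n. F (ys(i := y))) = real CARD('a) * (\<Sum>y\<in>UNIV. \<Sum>ys\<in>seqs n. of_bool (ys i = y) * F ys)"
    by (simp add: sum_distrib_left)
  also have "(\<Sum>y\<in>UNIV. \<Sum>ys\<in>seqs n. of_bool (ys i = y) * F ys) = (\<Sum>ys\<in>seqs n. F ys)"
    by (subst sum.swap) (simp only: sum_of_bool_eq)
  finally show ?thesis .
qed

text \<open>Only the factor at \<open>i\<close> changes. The ratio is cross-multiplied because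
  either factor may be 0.\<close>

lemma seq_prob_upd:
  assumes "i < n"
  shows "seq_prob p n xs (ys(i := y)) * pmf p (xs i, ys i) = seq_prob p n xs ys * pmf p (xs i, y)"
proof -
  have "seq_prob p n xs zs = pmf p (xs i, zs i) * (\<Prod>j\<in>{..<n} - {i}. pmf p (xs j, zs j))" for zs
    unfolding seq_prob_def using assms by (intro prod.remove) auto
  moreover have "(\<Prod>j\<in>{..<n} - {i}. pmf p (xs j, (ys(i := y)) j)) = (\<Prod>j\<in>{..<n} - {i}. pmf p (xs j, ys j))"
    by (intro prod.cong) auto
  ultimately show ?thesis by simp
qed

section \<open>The law of a source block and its single-letter marginals\<close>

abbreviation seq_pairs :: "nat \<Rightarrow> ((nat \<Rightarrow> 'x) \<times> (nat \<Rightarrow> 'y)) set" where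
  "seq_pairs n \<equiv> seqs n \<times> seqs n"

definition seq_weight :: "('x \<times> 'y) pmf \<Rightarrow> nat \<Rightarrow> (nat \<Rightarrow> 'x) \<times> (nat \<Rightarrow> 'y) \<Rightarrow> real" where
  "seq_weight p n = (\<lambda>(xs, ys). seq_prob p n xs ys)"

lemma finite_prob_seq_weight: "finite_prob (seq_pairs n) (seq_weight p n)"
  for p :: "('x::finite \<times> 'y::finite) pmf"
proof
  have "sum (seq_weight p n) (seq_pairs n) = (\<Sum>xs\<in>seqs n. \<Sum>ys\<in>seqs n. seq_prob p n xs ys)"
    by (simp add: seq_weight_def sum.cartesian_product)
  also have "\<dots> = 1"
    unfolding seq_prob_def sum_seqs_prod2[of "\<lambda>x y. pmf p (x, y)"] sum_pmf_pair by simp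
  finally show "sum (seq_weight p n) (seq_pairs n) = 1" .
qed (auto simp: seq_weight_def seq_prob_nonneg)

lemma prb_coord:
  fixes p :: "('x::finite \<times> 'y::finite) pmf"
  assumes i: "i < n"
  shows "prb (seq_pairs n) (seq_weight p n) (\<lambda>\<omega>. (fst \<omega> i, snd \<omega> i)) (x, y) = pmf p (x, y)"
proof -
  \<comment> \<open>The indicator of the event is put into factor \<open>i\<close>, so that the sum
    over blocks still factorises.\<close>
  define h where "h j a b = pmf p (a, b) * (if j = i then of_bool (a = x \<and> b = y) else 1)" for j a b
  have "prb (seq_pairs n) (seq_weight p n) (\<lambda>\<omega>. (fst \<omega> i, snd \<omega> i)) (x, y)
     = (\<Sum>xs\<in>seqs n. \<Sum>ys\<in>seqs n. seq_prob p n xs ys * of_bool (xs i = x \<and> ys i = y))"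
    unfolding prb_def sum.cartesian_product by (intro sum.cong refl) (auto simp: seq_weight_def)
  also have "\<dots> = (\<Sum>xs\<in>seqs n. \<Sum>ys\<in>seqs n. \<Prod>j<n. h j (xs j) (ys j))"
    using i by (intro sum.cong refl) (simp add: h_def seq_prob_def prod.distrib)
  also have "\<dots> = (\<Sum>xs\<in>seqs n. \<Prod>j<n. \<Sum>b\<in>UNIV. h j (xs j) b)"
    by (intro sum.cong refl) (rule sum_seqs_prod)
  also have "\<dots> = (\<Prod>j<n. \<Sum>a\<in>UNIV. \<Sum>b\<in>UNIV. h j a b)"
    by (rule sum_seqs_prod)
  also have "\<dots> = (\<Prod>j<n. if j = i then pmf p (x, y) else 1)"
  proof (intro prod.cong refl)
    fix j
    have "(\<Sum>a\<in>UNIV. \<Sum>b\<in>UNIV. pmf p (a, b) * of_bool (a = x \<and> b = y))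
       = (\<Sum>a\<in>UNIV. if x = a then \<Sum>b\<in>UNIV. if y = b then pmf p (a, b) else 0 else 0)"
      by (intro sum.cong refl) (auto intro!: sum.cong)
    then show "(\<Sum>a\<in>UNIV. \<Sum>b\<in>UNIV. h j a b) = (if j = i then pmf p (x, y) else 1)"
      by (simp add: h_def sum_pmf_pair)
  qed
  also have "\<dots> = pmf p (x, y)" using i by simp
  finally show ?thesis .
qed

lemma exists_pmf:
  fixes q :: "'v::finite \<Rightarrow> real"
  assumes "\<And>v. q v \<ge> 0" "(\<Sum>v\<in>UNIV. q v) = 1"
  shows "\<exists>Q. \<forall>v. pmf Q v = q v"
proof -
  have "(\<integral>\<^sup>+ v. ennreal (q v) \<partial>count_space UNIV) = 1"
    using assms by (simp add: nn_integral_count_space_finite sum_ennreal)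
  then show ?thesis using assms(1) by (intro exI[of _ "embed_pmf q"]) (simp add: pmf_embed_pmf)
qed

text \<open>A function of the block that ignores the \<open>i\<close>-th side information symbol satisfies the Markov
  condition with respect to the \<open>i\<close>-th source pair, so it defines a test channel.\<close>
lemma exists_test_channel:
  fixes p :: "('x::finite \<times> 'y::finite) pmf" and V :: "(nat \<Rightarrow> 'x) \<times> (nat \<Rightarrow> 'y) \<Rightarrow> 'v::finite"
  assumes i: "i < n" and V: "\<And>xs ys y. V (xs, ys(i := y)) = V (xs, ys)"
  shows "\<exists>Q :: 'x \<Rightarrow> 'v pmf. \<forall>v x y. pmf p (x, y) * pmf (Q x) v =
     prb (seq_pairs n) (seq_weight p n) (\<lambda>\<omega>. ((V \<omega>, snd \<omega> i), fst \<omega> i)) ((v, y), x)"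
proof -
  interpret finite_prob "seq_pairs n" "seq_weight p n" by (rule finite_prob_seq_weight)
  define a where "a v x y = prb (seq_pairs n) (seq_weight p n) (\<lambda>\<omega>. ((V \<omega>, snd \<omega> i), fst \<omega> i)) ((v, y), x)" for v x y
  define PX where "PX x = (\<Sum>y\<in>UNIV. pmf p (x, y))" for x
  have a0: "a v x y \<ge> 0" for v x y by (simp add: a_def prb0)
  have a_eq: "a v x y = (\<Sum>xs\<in>seqs n. \<Sum>ys\<in>seqs n. of_bool (ys i = y) * (of_bool (xs i = x \<and> V (xs, ys) = v) * seq_prob p n xs ys))" for v x y
  proof -
    have "a v x y = (\<Sum>\<omega>\<in>seq_pairs n. case \<omega> of (xs, ys) \<Rightarrow> of_bool (ys i = y) * (of_bool (xs i = x \<and> V (xs, ys) = v) * seq_prob p n xs ys))"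
      unfolding a_def prb_def by (intro sum.cong refl) (auto simp: seq_weight_def)
    then show ?thesis by (simp only: sum.cartesian_product)
  qed
  \<comment> \<open>The Markov condition without division: given \<open>x\<close>, the law of
    \<open>v\<close> is the same for \<open>y\<close> and \<open>y'\<close>. Exchanging the two
    symbols at position \<open>i\<close> leaves \<open>V\<close> unchanged and alters only one
    factor of the probability.\<close>
  have markov: "a v x y * pmf p (x, y') = a v x y' * pmf p (x, y)" for v x y y'
  proof -
    have "a v x y = (\<Sum>xs\<in>seqs n. \<Sum>ys\<in>seqs n. of_bool (ys i = y') * (of_bool (xs i = x \<and> V (xs, ys(i := y)) = v) * seq_prob p n xs (ys(i := y))))"
      unfolding a_eq by (intro sum.cong refl sum_seqs_fix_coord[OF i])
    then have "a v x y * pmf p (x, y') = (\<Sum>xs\<in>seqs n. \<Sum>ys\<in>seqs n.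
        of_bool (ys i = y') * (of_bool (xs i = x \<and> V (xs, ys) = v) * (seq_prob p n xs (ys(i := y)) * pmf p (x, y'))))"
      by (simp only: V sum_distrib_right mult.assoc)
    also have "\<dots> = (\<Sum>xs\<in>seqs n. \<Sum>ys\<in>seqs n.
        of_bool (ys i = y') * (of_bool (xs i = x \<and> V (xs, ys) = v) * (seq_prob p n xs ys * pmf p (x, y))))"
    proof (intro sum.cong refl)
      fix xs ys
      show "of_bool (ys i = y') * (of_bool (xs i = x \<and> V (xs, ys) = v) * (seq_prob p n xs (ys(i := y)) * pmf p (x, y')))
        = of_bool (ys i = y') * (of_bool (xs i = x \<and> V (xs, ys) = v) * (seq_prob p n xs ys * pmf p (x, y)))"
        using seq_prob_upd[OF i, of p xs ys y] by (cases "ys i = y' \<and> xs i = x") auto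
    qed
    also have "\<dots> = a v x y' * pmf p (x, y)"
      unfolding a_eq by (simp only: sum_distrib_right mult.assoc)
    finally show ?thesis .
  qed
  have marg: "(\<Sum>v\<in>UNIV. a v x y) = pmf p (x, y)" for x y
  proof -
    have "pmf p (x, y) = (\<Sum>v\<in>UNIV. prb (seq_pairs n) (seq_weight p n) (\<lambda>\<omega>. ((fst \<omega> i, snd \<omega> i), V \<omega>)) ((x, y), v))"
      by (subst prb_fst[symmetric]) (simp add: prb_coord[OF i])
    also have "\<dots> = (\<Sum>v\<in>UNIV. a v x y)"
      unfolding a_def prb_def by (intro sum.cong refl) auto
    finally show ?thesis by simp
  qed
  have "\<exists>q. \<forall>v y. pmf p (x, y) * pmf q v = a v x y" for x
  proof (cases "PX x = 0")
    \<comment> \<open>For \<open>x\<close> of probability 0 both sides vanish, so any law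
      serves.\<close>
    case True
    then have p0: "pmf p (x, y) = 0" for y
      by (simp add: PX_def sum_nonneg_eq_0_iff)
    then have "a v x y = 0" for v y
      using marg[of x y] a0 by (simp add: sum_nonneg_eq_0_iff)
    then show ?thesis using p0 by simp
  next
    case False
    then have pos: "PX x > 0" using sum_nonneg[of UNIV "\<lambda>y. pmf p (x, y)"] by (simp add: PX_def less_le)
    have "(\<Sum>v\<in>UNIV. \<Sum>y\<in>UNIV. a v x y) = PX x"
      unfolding PX_def by (subst sum.swap) (simp add: marg)
    then have "(\<Sum>v\<in>UNIV. (\<Sum>y\<in>UNIV. a v x y) / PX x) = 1"
      using pos by (simp flip: sum_divide_distrib)
    then obtain q where q: "\<And>v. pmf q v = (\<Sum>y\<in>UNIV. a v x y) / PX x"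
      using exists_pmf[of "\<lambda>v. (\<Sum>y\<in>UNIV. a v x y) / PX x"] a0 pos by (auto simp: sum_nonneg)
    have "pmf p (x, y) * pmf q v = a v x y" for v y
    proof -
      have "a v x y * PX x = (\<Sum>y'\<in>UNIV. a v x y') * pmf p (x, y)"
        unfolding PX_def sum_distrib_left sum_distrib_right by (intro sum.cong refl markov)
      then show ?thesis using pos by (simp add: q field_simps)
    qed
    then show ?thesis by blast
  qed
  then have "\<forall>x. \<exists>q. \<forall>v y. pmf p (x, y) * pmf q v = a v x y" by blast
  from choice[OF this] show ?thesis unfolding a_def by blast
qed

lemma sum_UNIV_pair: "(\<Sum>a\<in>UNIV. g a) = (\<Sum>b\<in>UNIV. \<Sum>c\<in>UNIV. g (b, c))"
  for g :: "'b::finite \<times> 'c::finite \<Rightarrow> real"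
  unfolding sum.cartesian_product by (rule sum.cong) auto

text \<open>The information as a difference of conditional entropies, taken over blocks: the first
  sum is minus the entropy of X given V and Y, the second is the entropy of X given Y at position
  \<open>i\<close>. The second depends only on the source.\<close>

lemma cond_mutual_info_eq_sum:
  fixes p :: "('x::finite \<times> 'y::finite) pmf" and V :: "(nat \<Rightarrow> 'x) \<times> (nat \<Rightarrow> 'y) \<Rightarrow> 'x set"
  assumes i: "i < n"
    and Q: "\<And>v x y. pmf p (x, y) * pmf (Q x) v =
     prb (seq_pairs n) (seq_weight p n) (\<lambda>\<omega>. ((V \<omega>, snd \<omega> i), fst \<omega> i)) ((v, y), x)"
  shows "cond_mutual_info p Q =
    (\<Sum>\<omega>\<in>seq_pairs n. seq_weight p n \<omega> * log 2 (
       prb (seq_pairs n) (seq_weight p n) (\<lambda>\<omega>. ((V \<omega>, snd \<omega> i), fst \<omega> i)) ((V \<omega>, snd \<omega> i), fst \<omega> i) /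
       prb (seq_pairs n) (seq_weight p n) (\<lambda>\<omega>. (V \<omega>, snd \<omega> i)) (V \<omega>, snd \<omega> i)))
    + (\<Sum>\<omega>\<in>seq_pairs n. seq_weight p n \<omega> * log 2 (pmf (map_pmf snd p) (snd \<omega> i) / pmf p (fst \<omega> i, snd \<omega> i)))"
proof -
  interpret finite_prob "seq_pairs n" "seq_weight p n" by (rule finite_prob_seq_weight)
  define A where "A = prb (seq_pairs n) (seq_weight p n) (\<lambda>\<omega>. ((V \<omega>, snd \<omega> i), fst \<omega> i))"
  define B where "B = prb (seq_pairs n) (seq_weight p n) (\<lambda>\<omega>. (V \<omega>, snd \<omega> i))"
  define PY where "PY = pmf (map_pmf snd p)"
  define F where "F = (\<lambda>((v, y), x). log 2 (A ((v, y), x) * PY y / (B (v, y) * pmf p (x, y))))"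
  have B: "(\<Sum>x\<in>UNIV. A ((v, y), x)) = B (v, y)" for v y
    unfolding A_def B_def by (rule prb_fst[symmetric])
  have A0: "A a \<ge> 0" for a by (simp add: A_def prb0)
  have "cond_mutual_info p Q = (\<Sum>v\<in>UNIV. \<Sum>x\<in>UNIV. \<Sum>y\<in>UNIV. A ((v, y), x) * F ((v, y), x))"
    unfolding cond_mutual_info_def Let_def Q A_def[symmetric] B PY_def[symmetric] F_def
    using A0 by (intro sum.cong refl) (auto simp: less_le)
  also have "\<dots> = (\<Sum>v\<in>UNIV. \<Sum>y\<in>UNIV. \<Sum>x\<in>UNIV. A ((v, y), x) * F ((v, y), x))"
    by (intro sum.cong refl sum.swap)
  also have "\<dots> = (\<Sum>a\<in>UNIV. A a * F a)"
    by (simp only: sum_UNIV_pair[of "\<lambda>a. A a * F a"] sum_UNIV_pair[of "\<lambda>b. \<Sum>x\<in>UNIV. A (b, x) * F (b, x)"])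
  also have "\<dots> = (\<Sum>\<omega>\<in>seq_pairs n. seq_weight p n \<omega> * F ((V \<omega>, snd \<omega> i), fst \<omega> i))"
    unfolding A_def by (rule sum_eq_sum_prb[symmetric]) auto
  also have "\<dots> = (\<Sum>\<omega>\<in>seq_pairs n. seq_weight p n \<omega> * log 2 (A ((V \<omega>, snd \<omega> i), fst \<omega> i) / B (V \<omega>, snd \<omega> i))
     + seq_weight p n \<omega> * log 2 (PY (snd \<omega> i) / pmf p (fst \<omega> i, snd \<omega> i)))"
  proof (intro sum.cong refl)
    fix \<omega> :: "(nat \<Rightarrow> 'x) \<times> (nat \<Rightarrow> 'y)" assume \<omega>: "\<omega> \<in> seq_pairs n"
    show "seq_weight p n \<omega> * F ((V \<omega>, snd \<omega> i), fst \<omega> i) = seq_weight p n \<omega> * log 2 (A ((V \<omega>, snd \<omega> i), fst \<omega> i) / B (V \<omega>, snd \<omega> i))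
     + seq_weight p n \<omega> * log 2 (PY (snd \<omega> i) / pmf p (fst \<omega> i, snd \<omega> i))"
    proof (cases "seq_weight p n \<omega> = 0")
      case False
      then have w: "seq_weight p n \<omega> > 0" using w0[of \<omega>] by simp
      then have p: "pmf p (fst \<omega> i, snd \<omega> i) > 0"
        using i by (simp add: seq_weight_def case_prod_unfold seq_prob_pos_iff)
      then have py: "PY (snd \<omega> i) > 0"
        unfolding PY_def pmf_map_snd by (intro sum_pos2[of _ "fst \<omega> i"]) auto
      have "A ((V \<omega>, snd \<omega> i), fst \<omega> i) > 0" "B (V \<omega>, snd \<omega> i) > 0"
        unfolding A_def B_def by (rule prb_pos[OF \<omega> w])+
      with p py show ?thesis
        by (simp add: F_def log_divide_pos log_mult_pos algebra_simps)
    qed simp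
  qed
  also have "\<dots> = (\<Sum>\<omega>\<in>seq_pairs n. seq_weight p n \<omega> * log 2 (A ((V \<omega>, snd \<omega> i), fst \<omega> i) / B (V \<omega>, snd \<omega> i)))
     + (\<Sum>\<omega>\<in>seq_pairs n. seq_weight p n \<omega> * log 2 (PY (snd \<omega> i) / pmf p (fst \<omega> i, snd \<omega> i)))"
    by (rule sum.distrib)
  finally show ?thesis unfolding A_def B_def PY_def .
qed

section \<open>Converse and rate region\<close>

text \<open>Makes \<open>Inf\<close> a genuine lower bound on the reals. A crude estimate is enough:
  \<open>PVY \<le> PY\<close> bounds the logarithm below by \<open>log 2 (pmf (Q x) v)\<close>, and
  \<open>t * ln t \<ge> -1\<close>, so each of the finitely many summands is at least
  \<open>- 1 / ln 2\<close>.\<close>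

lemma bdd_below_cond_mutual_info: "bdd_below {cond_mutual_info p Q | Q. admissible_V p f Q}"
  for p :: "('x::finite \<times> 'y::finite) pmf"
proof (rule bdd_belowI, clarify)
  fix Q :: "'x \<Rightarrow> 'x set pmf"
  interpret memoryless_source "\<lambda>x y. pmf p (x, y)" "\<lambda>x. pmf (Q x)" by (rule memoryless_source_pmf)
  have summand_ge: "- 1 / ln 2 \<le> (if pmf p (x, y) * pmf (Q x) v > 0 then pmf p (x, y) * pmf (Q x) v *
      log 2 (pmf p (x, y) * pmf (Q x) v * PY y / (PVY v y * pmf p (x, y))) else 0)" for v x y
  proof (cases "pmf p (x, y) * pmf (Q x) v > 0")
    case True
    then have pos: "pmf p (x, y) > 0" "pmf (Q x) v > 0" by (auto simp: zero_less_mult_iff)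
    have V: "PVY v y > 0" using True PVY_pos_iff by blast
    have "PVY v y \<le> PY y"
      unfolding PVY_def PY_def by (intro sum_mono) (simp add: mult_left_le pmf_le_1)
    then have "pmf (Q x) v * 1 \<le> pmf (Q x) v * (PY y / PVY v y)"
      using V by (intro mult_left_mono) auto
    then have "log 2 (pmf (Q x) v) \<le> log 2 (pmf p (x, y) * pmf (Q x) v * PY y / (PVY v y * pmf p (x, y)))"
      using pos V PVY_pos_imp[OF V] by (subst log_le_cancel_iff) (auto simp: field_simps)
    moreover have "- 1 / ln 2 \<le> pmf (Q x) v * log 2 (pmf (Q x) v)"
    proof -
      have "ln (1 / pmf (Q x) v) \<le> 1 / pmf (Q x) v - 1"
        using pos by (intro ln_le_minus_one) simp
      then have "pmf (Q x) v * (- ln (pmf (Q x) v)) \<le> pmf (Q x) v * (1 / pmf (Q x) v - 1)"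
        using pos by (intro mult_left_mono) (auto simp: ln_divide_pos)
      also have "\<dots> \<le> 1" using pos by (simp add: right_diff_distrib)
      finally have "- 1 / ln 2 \<le> pmf (Q x) v * ln (pmf (Q x) v) / ln 2"
        by (intro divide_right_mono) auto
      then show ?thesis by (simp add: log_def)
    qed
    ultimately have "- 1 / ln 2 \<le> pmf (Q x) v * log 2 (pmf p (x, y) * pmf (Q x) v * PY y / (PVY v y * pmf p (x, y)))"
      by (elim order_trans) (intro mult_left_mono, auto)
    then have "pmf p (x, y) * (- 1 / ln 2) \<le> pmf p (x, y) * (pmf (Q x) v * log 2 (pmf p (x, y) * pmf (Q x) v * PY y / (PVY v y * pmf p (x, y))))"
      by (intro mult_left_mono) auto
    moreover have "- 1 / ln 2 \<le> pmf p (x, y) * (- 1 / ln 2)"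
      using divide_right_mono[OF pmf_le_1[of p "(x, y)"], of "ln 2"] by simp
    ultimately show ?thesis using True by (simp add: mult.assoc)
  qed simp
  show "(\<Sum>v\<in>(UNIV::'x set set). \<Sum>x\<in>(UNIV::'x set). \<Sum>y\<in>(UNIV::'y set). - 1 / ln 2) \<le> cond_mutual_info p Q"
    unfolding cond_mutual_info_eq IX_minus_IY by (intro sum_mono summand_ge)
qed

lemma cond_graph_entropy_le: "admissible_V p f Q \<Longrightarrow> cond_graph_entropy p f \<le> cond_mutual_info p Q"
  for p :: "('x::finite \<times> 'y::finite) pmf"
  unfolding cond_graph_entropy_def by (rule cInf_lower[OF _ bdd_below_cond_mutual_info]) blast

text \<open>One block code; nothing is assumed of its maps, so message ranges and error bounds
  appear in the lemmas that use them.\<close>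

locale code =
  fixes p :: "('x::finite \<times> 'y::finite) pmf" and f :: "'x \<Rightarrow> 'y \<Rightarrow> 'f" and n :: nat
    and \<phi>0 :: "(nat \<Rightarrow> 'x) \<Rightarrow> nat" and \<phi>X :: "(nat \<Rightarrow> 'x) \<Rightarrow> nat"
    and \<phi>Y :: "(nat \<Rightarrow> 'y) \<Rightarrow> nat \<Rightarrow> nat" and \<psi> :: "nat \<Rightarrow> nat \<Rightarrow> (nat \<Rightarrow> 'f)"
begin

sublocale finite_prob "seq_pairs n" "seq_weight p n" by (rule finite_prob_seq_weight)

text \<open>The message of Y is a function of the first and third components. The past of X is
  included so that adjoining symbol \<open>i\<close> of X gives the next \<open>Z\<close>.\<close>

definition Z :: "nat \<Rightarrow> (nat \<Rightarrow> 'x) \<times> (nat \<Rightarrow> 'y) \<Rightarrow> nat \<times> nat \<times> (nat \<Rightarrow> 'y) \<times> (nat \<Rightarrow> 'x)" where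
  "Z i = (\<lambda>(xs, ys). (\<phi>0 xs, \<phi>X xs, ys, restrict xs {..<i}))"

text \<open>The source symbols for which the decoder would be right at position \<open>i\<close> whatever the \<open>i\<close>-th
  side information symbol is. Such a set is independent in the characteristic graph.\<close>
definition D :: "nat \<Rightarrow> nat \<times> nat \<times> (nat \<Rightarrow> 'y) \<times> (nat \<Rightarrow> 'x) \<Rightarrow> 'x set" where
  "D i = (\<lambda>(m0, mX, ys, _). {x. \<forall>y. pmf p (x, y) > 0 \<longrightarrow> f x y = \<psi> mX (\<phi>Y (ys(i := y)) m0) i})"

text \<open>The fallback \<open>{x}\<close> is independent and contains \<open>x\<close>, so
  \<open>G\<close> is admissible even where the decoder errs.\<close>

definition G :: "nat \<Rightarrow> nat \<times> nat \<times> (nat \<Rightarrow> 'y) \<times> (nat \<Rightarrow> 'x) \<Rightarrow> 'x \<Rightarrow> 'x set" where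
  "G i z x = (if x \<in> D i z then D i z else {x})"

definition V :: "nat \<Rightarrow> (nat \<Rightarrow> 'x) \<times> (nat \<Rightarrow> 'y) \<Rightarrow> 'x set" where
  "V i \<omega> = G i (Z i \<omega>) (fst \<omega> i)"

lemma indep_G: "indep_set p f (G i z x)" and mem_G: "x \<in> G i z x"
proof -
  have "f x1 y = f x2 y" if "x1 \<in> D i z" "x2 \<in> D i z" "pmf p (x1, y) * pmf p (x2, y) > 0" for x1 x2 y
  proof -
    have "pmf p (x1, y) > 0" "pmf p (x2, y) > 0" using that(3) by (auto simp: zero_less_mult_iff)
    then show ?thesis using that(1,2) by (cases z) (simp add: D_def)
  qed
  then show "indep_set p f (G i z x)"
    by (auto simp: indep_set_def char_adj_def G_def)
  show "x \<in> G i z x" by (simp add: G_def)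
qed

text \<open>\<open>D i\<close> overwrites position \<open>i\<close> of the side information, so
  \<open>V i\<close> ignores it, as \<open>exists_test_channel\<close> requires.\<close>

lemma V_upd: "V i (xs, ys(i := y)) = V i (xs, ys)"
proof -
  have "D i (Z i (xs, ys(i := y))) = D i (Z i (xs, ys))" by (simp add: Z_def D_def)
  then show ?thesis by (simp add: V_def G_def)
qed

text \<open>If symbol \<open>i\<close> of X is outside \<open>D i\<close>, some replacement of
  symbol \<open>i\<close> of Y produces a decoding error, and the replaced block has at least
  \<open>c\<close> times the original probability. Summing over all replacements counts each block
  \<open>CARD('y)\<close> times.\<close>

lemma error_at_position_le:
  assumes i: "i < n" and c: "c > 0" "\<And>z. pmf p z > 0 \<Longrightarrow> pmf p z \<ge> c"
  shows "(\<Sum>\<omega>\<in>seq_pairs n. seq_weight p n \<omega> * of_bool (V i \<omega> \<noteq> D i (Z i \<omega>)))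
     \<le> real CARD('y) / c * err_prob p f n \<phi>0 \<phi>X \<phi>Y \<psi>"
proof -
  define wrong where "wrong xs ys \<longleftrightarrow> \<psi> (\<phi>X xs) (\<phi>Y ys (\<phi>0 xs)) i \<noteq> f (xs i) (ys i)" for xs ys
  have pt: "seq_prob p n xs ys * of_bool (V i (xs, ys) \<noteq> D i (Z i (xs, ys)))
     \<le> (\<Sum>y\<in>UNIV. seq_prob p n xs (ys(i := y)) / c * of_bool (wrong xs (ys(i := y))))" for xs ys
  proof (cases "V i (xs, ys) = D i (Z i (xs, ys))")
    case True
    then show ?thesis using c by (auto intro!: sum_nonneg simp: seq_prob_nonneg)
  next
    case False
    then have "xs i \<notin> D i (Z i (xs, ys))" by (auto simp: V_def G_def)
    then obtain y where y: "pmf p (xs i, y) > 0" "wrong xs (ys(i := y))"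
      by (auto simp: D_def Z_def wrong_def)
    have "seq_prob p n xs ys * c \<le> seq_prob p n xs ys * pmf p (xs i, y)"
      using c(2)[OF y(1)] by (intro mult_left_mono seq_prob_nonneg)
    also have "\<dots> = seq_prob p n xs (ys(i := y)) * pmf p (xs i, ys i)"
      by (rule seq_prob_upd[OF i, symmetric])
    also have "\<dots> \<le> seq_prob p n xs (ys(i := y))"
      using seq_prob_nonneg[of p n xs "ys(i := y)"] by (simp add: mult_left_le pmf_le_1)
    finally have "seq_prob p n xs ys \<le> seq_prob p n xs (ys(i := y)) / c * of_bool (wrong xs (ys(i := y)))"
      using c(1) y(2) by (simp add: field_simps)
    also have "\<dots> \<le> (\<Sum>y\<in>UNIV. seq_prob p n xs (ys(i := y)) / c * of_bool (wrong xs (ys(i := y))))"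
      using c(1) by (intro member_le_sum) (auto simp: seq_prob_nonneg)
    finally show ?thesis using False by simp
  qed
  have "(\<Sum>\<omega>\<in>seq_pairs n. seq_weight p n \<omega> * of_bool (V i \<omega> \<noteq> D i (Z i \<omega>)))
     = (\<Sum>xs\<in>seqs n. \<Sum>ys\<in>seqs n. seq_prob p n xs ys * of_bool (V i (xs, ys) \<noteq> D i (Z i (xs, ys))))"
    unfolding sum.cartesian_product by (intro sum.cong refl) (auto simp: seq_weight_def)
  also have "\<dots> \<le> (\<Sum>xs\<in>seqs n. \<Sum>ys\<in>seqs n. \<Sum>y\<in>UNIV. seq_prob p n xs (ys(i := y)) / c * of_bool (wrong xs (ys(i := y))))"
    by (intro sum_mono pt)
  also have "\<dots> = (\<Sum>xs\<in>seqs n. \<Sum>y\<in>UNIV. \<Sum>ys\<in>seqs n. seq_prob p n xs (ys(i := y)) / c * of_bool (wrong xs (ys(i := y))))"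
    by (intro sum.cong refl sum.swap)
  also have "\<dots> = (\<Sum>xs\<in>seqs n. real CARD('y) * (\<Sum>ys\<in>seqs n. seq_prob p n xs ys / c * of_bool (wrong xs ys)))"
    by (intro sum.cong refl sum_seqs_resample[OF i])
  also have "\<dots> = real CARD('y) / c * (\<Sum>xs\<in>seqs n. \<Sum>ys\<in>seqs n. seq_prob p n xs ys * of_bool (wrong xs ys))"
    unfolding sum_distrib_left by (intro sum.cong refl) simp
  also have "\<dots> \<le> real CARD('y) / c * err_prob p f n \<phi>0 \<phi>X \<phi>Y \<psi>"
    unfolding err_prob_def sum.cartesian_product using i c(1)
    by (intro mult_left_mono sum_mono) (auto simp: wrong_def seq_prob_nonneg)
  finally show ?thesis .
qed

text \<open>Each variable determines the other; this is what makes the entropy differences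
  telescope.\<close>

lemma ent_Z_Suc:
  assumes "i < n"
  shows "ent (seq_pairs n) (seq_weight p n) (\<lambda>\<omega>. (Z i \<omega>, fst \<omega> i)) = ent (seq_pairs n) (seq_weight p n) (Z (Suc i))"
proof (rule ent_cong)
  fix \<omega> \<omega>' :: "(nat \<Rightarrow> 'x) \<times> (nat \<Rightarrow> 'y)"
  obtain xs ys xs' ys' where w: "\<omega> = (xs, ys)" "\<omega>' = (xs', ys')" by (cases \<omega>, cases \<omega>')
  have "restrict xs {..<Suc i} = restrict xs' {..<Suc i} \<longleftrightarrow> restrict xs {..<i} = restrict xs' {..<i} \<and> xs i = xs' i"
    by (auto simp: fun_eq_iff restrict_def less_Suc_eq)
  then show "(Z i \<omega>, fst \<omega> i) = (Z i \<omega>', fst \<omega>' i) \<longleftrightarrow> Z (Suc i) \<omega> = Z (Suc i) \<omega>'"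
    by (auto simp: w Z_def)
qed

text \<open>\<open>V i\<close> yields an admissible test channel. Its information is the sum of two
  terms: \<open>information_perturbation\<close> replaces the first by an entropy increment of
  \<open>Z\<close> plus a small cost, and the second is kept.\<close>

lemma cond_graph_entropy_le_increment:
  assumes i: "i < n" and c: "c > 0" "\<And>z. pmf p z > 0 \<Longrightarrow> pmf p z \<ge> c"
    and err: "err_prob p f n \<phi>0 \<phi>X \<phi>Y \<psi> \<le> \<epsilon>" and \<theta>: "0 < \<theta>" "\<theta> < 1"
  shows "cond_graph_entropy p f \<le> ent (seq_pairs n) (seq_weight p n) (Z i) - ent (seq_pairs n) (seq_weight p n) (Z (Suc i))
     + (- log 2 (1 - \<theta>) + real CARD('y) / c * \<epsilon> * log 2 (CARD('x set) / \<theta>))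
     + (\<Sum>\<omega>\<in>seq_pairs n. seq_weight p n \<omega> * log 2 (pmf (map_pmf snd p) (snd \<omega> i) / pmf p (fst \<omega> i, snd \<omega> i)))"
proof -
  obtain Q :: "'x \<Rightarrow> 'x set pmf" where Q: "\<And>v x y. pmf p (x, y) * pmf (Q x) v =
     prb (seq_pairs n) (seq_weight p n) (\<lambda>\<omega>. ((V i \<omega>, snd \<omega> i), fst \<omega> i)) ((v, y), x)"
    using exists_test_channel[OF i, where p = p and V = "V i", OF V_upd] by blast
  have "admissible_V p f Q"
    unfolding admissible_V_def
  proof (intro allI impI)
    fix x v assume pos: "pmf (map_pmf fst p) x * pmf (Q x) v > 0"
    then have "(\<Sum>y\<in>UNIV. pmf p (x, y) * pmf (Q x) v) > 0"
      by (simp add: pmf_map_fst sum_distrib_right)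
    then obtain y where "pmf p (x, y) * pmf (Q x) v > 0"
      by (metis (no_types, lifting) sum_nonpos not_le)
    then have "prb (seq_pairs n) (seq_weight p n) (\<lambda>\<omega>. ((V i \<omega>, snd \<omega> i), fst \<omega> i)) ((v, y), x) > 0"
      by (simp only: Q)
    from prb_pos_imp[OF this] obtain \<omega> where "V i \<omega> = v" "fst \<omega> i = x" by auto
    then show "indep_set p f v \<and> x \<in> v"
      unfolding V_def using indep_G mem_G by blast
  qed
  then have "cond_graph_entropy p f \<le> cond_mutual_info p Q" by (rule cond_graph_entropy_le)
  also note cond_mutual_info_eq_sum[OF i Q]
  also have "(\<Sum>\<omega>\<in>seq_pairs n. seq_weight p n \<omega> * log 2 (
       prb (seq_pairs n) (seq_weight p n) (\<lambda>\<omega>. ((V i \<omega>, snd \<omega> i), fst \<omega> i)) ((V i \<omega>, snd \<omega> i), fst \<omega> i) /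
       prb (seq_pairs n) (seq_weight p n) (\<lambda>\<omega>. (V i \<omega>, snd \<omega> i)) (V i \<omega>, snd \<omega> i)))
    \<le> ent (seq_pairs n) (seq_weight p n) (Z i) - ent (seq_pairs n) (seq_weight p n) (\<lambda>\<omega>. (Z i \<omega>, fst \<omega> i))
      + (- log 2 (1 - \<theta>) + real CARD('y) / c * \<epsilon> * log 2 (CARD('x set) / \<theta>))"
  proof -
    have "(\<Sum>\<omega>\<in>seq_pairs n. seq_weight p n \<omega> * of_bool (G i (Z i \<omega>) (fst \<omega> i) \<noteq> D i (Z i \<omega>))) \<le> real CARD('y) / c * \<epsilon>"
      using error_at_position_le[OF i c] err c(1) unfolding V_def
      by (meson divide_nonneg_pos mult_left_mono of_nat_0_le_iff order_trans)
    \<comment> \<open>Here \<open>Y\<close> reads symbol \<open>i\<close> of the side information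
      off \<open>Z i\<close>.\<close>
    from information_perturbation[where G = "G i" and Z = "Z i" and X = "\<lambda>\<omega>. fst \<omega> i" and D = "D i"
        and Y = "\<lambda>(_, _, ys, _). ys i", OF \<theta> this]
    show ?thesis unfolding V_def by (simp add: Z_def case_prod_unfold)
  qed
  finally show ?thesis unfolding ent_Z_Suc[OF i] by simp
qed

text \<open>\<open>Z n\<close> determines the whole block, so its entropy is the joint entropy of
  the two sequences.\<close>

lemma ent_Z_last: "ent (seq_pairs n) (seq_weight p n) (Z n) = (\<Sum>\<omega>\<in>seq_pairs n. seq_weight p n \<omega> * log 2 (1 / seq_weight p n \<omega>))"
  unfolding ent_def
proof (intro sum.cong refl)
  fix \<omega> :: "(nat \<Rightarrow> 'x) \<times> (nat \<Rightarrow> 'y)" assume \<omega>: "\<omega> \<in> seq_pairs n"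
  have "restrict xs {..<n} = xs" if "xs \<in> seqs n" for xs :: "nat \<Rightarrow> 'x"
    using that by (auto simp: seqs_def fun_eq_iff restrict_def PiE_iff extensional_def)
  then have "Z n \<omega>' = Z n \<omega> \<longleftrightarrow> \<omega> = \<omega>'" if "\<omega>' \<in> seq_pairs n" for \<omega>'
    using \<omega> that by (auto simp: Z_def)
  then have "prb (seq_pairs n) (seq_weight p n) (Z n) (Z n \<omega>) = (\<Sum>\<omega>'\<in>seq_pairs n. if \<omega> = \<omega>' then seq_weight p n \<omega>' else 0)"
    unfolding prb_def by (intro sum.cong) auto
  also have "\<dots> = seq_weight p n \<omega>" using \<omega> by simp
  finally show "seq_weight p n \<omega> * log 2 (1 / prb (seq_pairs n) (seq_weight p n) (Z n) (Z n \<omega>))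
     = seq_weight p n \<omega> * log 2 (1 / seq_weight p n \<omega>)" by simp
qed

text \<open>The second sum is minus the entropy of the Y-block, so the claim bounds the entropy of
  the two messages given Y. It is Gibbs' inequality with reference law uniform on message pairs
  times the law of Y.\<close>

lemma ent_Z_0_le:
  assumes m0: "\<And>xs. xs \<in> seqs n \<Longrightarrow> \<phi>0 xs \<in> {1..M0}" and mX: "\<And>xs. xs \<in> seqs n \<Longrightarrow> \<phi>X xs \<in> {1..MX}"
    and M: "M0 > 0" "MX > 0"
  shows "ent (seq_pairs n) (seq_weight p n) (Z 0)
     + (\<Sum>\<omega>\<in>seq_pairs n. seq_weight p n \<omega> * log 2 (\<Prod>i<n. pmf (map_pmf snd p) (snd \<omega> i))) \<le> log 2 (real M0 * real MX)"
proof -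
  define PY where "PY ys = (\<Prod>i<n. pmf (map_pmf snd p) (ys i))" for ys
  define N where "N = real M0 * real MX"
  have N: "N > 0" using M by (simp add: N_def)
  define h :: "nat \<times> nat \<times> (nat \<Rightarrow> 'y) \<times> (nat \<Rightarrow> 'x) \<Rightarrow> real" where "h = (\<lambda>(m0, mX, ys, _). PY ys / N)"
  \<comment> \<open>The last component of \<open>Z 0\<close> is the empty past, a single
    value.\<close>
  define S where "S = {1..M0} \<times> {1..MX} \<times> (seqs n :: (nat \<Rightarrow> 'y) set) \<times> {restrict undefined {..<0} :: nat \<Rightarrow> 'x}"
  have PY0: "PY ys \<ge> 0" for ys unfolding PY_def by (intro prod_nonneg) auto
  have "(\<Sum>ys\<in>seqs n. PY ys) = 1"
    unfolding PY_def using sum_seqs_prod[of "\<lambda>_. pmf (map_pmf snd p)" n] by (simp add: sum_pmf_UNIV)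
  then have "sum h S = 1"
    using N unfolding S_def h_def sum.cartesian_product[symmetric]
    by (simp add: N_def M flip: sum_divide_distrib)
  moreover have PYpos: "PY (snd \<omega>) > 0" if "seq_weight p n \<omega> > 0" for \<omega>
    unfolding PY_def
  proof (intro prod_pos)
    fix i assume "i \<in> {..<n}"
    then have "pmf p (fst \<omega> i, snd \<omega> i) > 0"
      using that by (simp add: seq_weight_def case_prod_unfold seq_prob_pos_iff)
    then show "pmf (map_pmf snd p) (snd \<omega> i) > 0"
      unfolding pmf_map_snd by (intro sum_pos2[of _ "fst \<omega> i"]) auto
  qed
  moreover have hZ: "h (Z 0 \<omega>) = PY (snd \<omega>) / N" for \<omega> by (simp add: h_def Z_def case_prod_unfold)
  moreover have "Z 0 ` seq_pairs n \<subseteq> S"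
    using m0 mX by (auto simp: Z_def S_def restrict_def)
  moreover have "finite S" by (simp add: S_def)
  ultimately have gibbs: "(\<Sum>\<omega>\<in>seq_pairs n. seq_weight p n \<omega> * log 2 (h (Z 0 \<omega>) / prb (seq_pairs n) (seq_weight p n) (Z 0) (Z 0 \<omega>))) \<le> 0"
    using N PY0 by (intro gibbs_inequality[where S = S]) (auto simp: h_def)
  have "seq_weight p n \<omega> * log 2 (h (Z 0 \<omega>) / prb (seq_pairs n) (seq_weight p n) (Z 0) (Z 0 \<omega>))
     = seq_weight p n \<omega> * log 2 (1 / prb (seq_pairs n) (seq_weight p n) (Z 0) (Z 0 \<omega>))
       + seq_weight p n \<omega> * log 2 (PY (snd \<omega>)) - seq_weight p n \<omega> * log 2 N" if "\<omega> \<in> seq_pairs n" for \<omega>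
  proof (cases "seq_weight p n \<omega> = 0")
    case False
    then have w: "seq_weight p n \<omega> > 0" using w0[of \<omega>] by simp
    show ?thesis using PYpos[OF w] prb_pos[OF that w, of "Z 0"] N
      by (simp add: hZ log_divide_pos log_mult_pos algebra_simps)
  qed simp
  then have "(\<Sum>\<omega>\<in>seq_pairs n. seq_weight p n \<omega> * log 2 (h (Z 0 \<omega>) / prb (seq_pairs n) (seq_weight p n) (Z 0) (Z 0 \<omega>)))
    = ent (seq_pairs n) (seq_weight p n) (Z 0) + (\<Sum>\<omega>\<in>seq_pairs n. seq_weight p n \<omega> * log 2 (PY (snd \<omega>)))
      - sum (seq_weight p n) (seq_pairs n) * log 2 N"
    unfolding ent_def sum_distrib_right by (simp only: sum.distrib sum_subtractf cong: sum.cong)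
  then show ?thesis using gibbs w1 unfolding PY_def N_def by simp
qed

text \<open>The entropies of X given Y at the positions add up to the joint entropy minus that of
  the Y-block, since the law is a product. These terms cancel those of \<open>ent_Z_last\<close> and
  \<open>ent_Z_0_le\<close>.\<close>

lemma sum_log_ratio:
  "(\<Sum>i<n. \<Sum>\<omega>\<in>seq_pairs n. seq_weight p n \<omega> * log 2 (pmf (map_pmf snd p) (snd \<omega> i) / pmf p (fst \<omega> i, snd \<omega> i)))
   = (\<Sum>\<omega>\<in>seq_pairs n. seq_weight p n \<omega> * log 2 (\<Prod>i<n. pmf (map_pmf snd p) (snd \<omega> i)))
     + (\<Sum>\<omega>\<in>seq_pairs n. seq_weight p n \<omega> * log 2 (1 / seq_weight p n \<omega>))"
proof -
  have "(\<Sum>i<n. seq_weight p n \<omega> * log 2 (pmf (map_pmf snd p) (snd \<omega> i) / pmf p (fst \<omega> i, snd \<omega> i)))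
    = seq_weight p n \<omega> * log 2 (\<Prod>i<n. pmf (map_pmf snd p) (snd \<omega> i)) + seq_weight p n \<omega> * log 2 (1 / seq_weight p n \<omega>)" for \<omega>
  proof (cases "seq_weight p n \<omega> = 0")
    case False
    then have w: "seq_weight p n \<omega> > 0" using w0[of \<omega>] by simp
    then have pp: "pmf p (fst \<omega> i, snd \<omega> i) > 0" if "i < n" for i
      using that by (simp add: seq_weight_def case_prod_unfold seq_prob_pos_iff)
    have py: "pmf (map_pmf snd p) (snd \<omega> i) > 0" if "i < n" for i
      unfolding pmf_map_snd using pp[OF that] by (intro sum_pos2[of _ "fst \<omega> i"]) auto
    have "log 2 (\<Prod>i<n. pmf (map_pmf snd p) (snd \<omega> i)) = (\<Sum>i<n. log 2 (pmf (map_pmf snd p) (snd \<omega> i)))"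
      unfolding log_def sum_divide_distrib[symmetric] using py by (subst ln_prod) force+
    moreover have "log 2 (\<Prod>i<n. pmf p (fst \<omega> i, snd \<omega> i)) = (\<Sum>i<n. log 2 (pmf p (fst \<omega> i, snd \<omega> i)))"
      unfolding log_def sum_divide_distrib[symmetric] using pp by (subst ln_prod) force+
    moreover have "seq_weight p n \<omega> = (\<Prod>i<n. pmf p (fst \<omega> i, snd \<omega> i))"
      by (simp add: seq_weight_def seq_prob_def case_prod_unfold)
    moreover have "(\<Sum>i<n. log 2 (pmf (map_pmf snd p) (snd \<omega> i) / pmf p (fst \<omega> i, snd \<omega> i)))
       = (\<Sum>i<n. log 2 (pmf (map_pmf snd p) (snd \<omega> i)) - log 2 (pmf p (fst \<omega> i, snd \<omega> i)))"
      using pp py by (intro sum.cong refl) (simp add: log_divide_pos)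
    moreover have "log 2 (1 / seq_weight p n \<omega>) = - log 2 (seq_weight p n \<omega>)"
      using w by (simp add: log_divide_pos)
    ultimately show ?thesis
      by (simp only: sum_distrib_left[symmetric] sum_subtractf distrib_left[symmetric]) simp
  qed simp
  then show ?thesis by (subst sum.swap) (simp only: sum.distrib)
qed

text \<open>Sum the increments over all positions, telescope, and divide by \<open>n\<close>. The
  bound holds for each single block length, without a limit in \<open>n\<close>.\<close>

lemma converse_block:
  assumes n: "n > 0" and c: "c > 0" "\<And>z. pmf p z > 0 \<Longrightarrow> pmf p z \<ge> c"
    and m0: "\<And>xs. xs \<in> seqs n \<Longrightarrow> \<phi>0 xs \<in> {1..msgs n R0}" and mX: "\<And>xs. xs \<in> seqs n \<Longrightarrow> \<phi>X xs \<in> {1..msgs n RX}"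
    and err: "err_prob p f n \<phi>0 \<phi>X \<phi>Y \<psi> \<le> \<epsilon>" and \<theta>: "0 < \<theta>" "\<theta> < 1"
  shows "cond_graph_entropy p f \<le> R0 + RX + (- log 2 (1 - \<theta>) + real CARD('y) / c * \<epsilon> * log 2 (CARD('x set) / \<theta>))"
proof -
  define \<kappa> where "\<kappa> = - log 2 (1 - \<theta>) + real CARD('y) / c * \<epsilon> * log 2 (CARD('x set) / \<theta>)"
  define e where "e i = ent (seq_pairs n) (seq_weight p n) (Z i)" for i
  define t where "t i = (\<Sum>\<omega>\<in>seq_pairs n. seq_weight p n \<omega> * log 2 (pmf (map_pmf snd p) (snd \<omega> i) / pmf p (fst \<omega> i, snd \<omega> i)))" for i
  \<comment> \<open>A block exists, hence so does a message for it; the message sets are nonempty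
    and their logarithms may be compared.\<close>
  have "restrict undefined {..<n} \<in> (seqs n :: (nat \<Rightarrow> 'x) set)" by (auto simp: seqs_def)
  then have M: "msgs n R0 > 0" "msgs n RX > 0" using m0 mX by fastforce+
  have "(\<Sum>i<n. cond_graph_entropy p f) \<le> (\<Sum>i<n. e i - e (Suc i) + \<kappa> + t i)"
    unfolding e_def t_def \<kappa>_def
    by (intro sum_mono cond_graph_entropy_le_increment[OF _ c err \<theta>]) simp
  also have "\<dots> = (e 0 - e n) + real n * \<kappa> + (\<Sum>i<n. t i)"
    unfolding sum.distrib sum_lessThan_telescope' by simp
  also have "\<dots> = e 0 + (\<Sum>\<omega>\<in>seq_pairs n. seq_weight p n \<omega> * log 2 (\<Prod>i<n. pmf (map_pmf snd p) (snd \<omega> i))) + real n * \<kappa>"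
    unfolding t_def e_def sum_log_ratio ent_Z_last by simp
  also have "\<dots> \<le> log 2 (real (msgs n R0) * real (msgs n RX)) + real n * \<kappa>"
    unfolding e_def using ent_Z_0_le[OF m0 mX M] by simp
  also have "log 2 (real (msgs n R0) * real (msgs n RX)) \<le> log 2 (2 powr (real n * R0) * 2 powr (real n * RX))"
    using M by (subst log_le_cancel_iff) (auto intro!: mult_mono real_msgs_le)
  also have "\<dots> = real n * (R0 + RX)"
    by (simp add: powr_add[symmetric] distrib_left)
  finally have "real n * cond_graph_entropy p f \<le> real n * (R0 + RX + \<kappa>)"
    by (simp add: algebra_simps)
  then show ?thesis using n by (simp add: \<kappa>_def)
qed

end

text \<open>One positive block length per \<open>\<epsilon>\<close> suffices. First
  \<open>\<epsilon>\<close> tends to 0 with \<open>\<theta>\<close> fixed, and only then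
  \<open>\<theta>\<close>: the error term contains \<open>log 2 (CARD('x set) / \<theta>)\<close>,
  which is unbounded as \<open>\<theta>\<close> tends to 0.\<close>

lemma achievable_imp_cond_graph_entropy_le:
  fixes p :: "('x::finite \<times> 'y::finite) pmf" and f :: "'x \<Rightarrow> 'y \<Rightarrow> 'f"
  assumes "achievable p f (R0, RX, RY)"
  shows "cond_graph_entropy p f \<le> R0 + RX"
proof -
  define c where "c = Min ((pmf p) ` {z. pmf p z > 0})"
  have "{z. pmf p z > 0} \<noteq> {}"
    using set_pmf_not_empty[of p] by (auto simp: set_pmf_eq less_le)
  then have "c \<in> (pmf p) ` {z. pmf p z > 0}" unfolding c_def by (intro Min_in) auto
  then have c: "c > 0" "\<And>z. pmf p z > 0 \<Longrightarrow> pmf p z \<ge> c" by (auto simp: c_def)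
  have le: "cond_graph_entropy p f \<le> R0 + RX + (- log 2 (1 - \<theta>) + real CARD('y) / c * \<epsilon> * log 2 (CARD('x set) / \<theta>))"
    if \<epsilon>: "\<epsilon> > 0" and \<theta>: "0 < \<theta>" "\<theta> < 1" for \<epsilon> \<theta>
  proof -
    obtain N where N: "\<And>n. n \<ge> N \<Longrightarrow> good_code p f n R0 RX RY \<epsilon>"
      using assms \<epsilon> unfolding achievable_def by auto
    have "good_code p f (Suc N) R0 RX RY \<epsilon>" by (rule N) simp
    then obtain \<phi>0 \<phi>X \<phi>Y \<psi> where
      "\<And>xs. xs \<in> seqs (Suc N) \<Longrightarrow> \<phi>0 xs \<in> {1..msgs (Suc N) R0}"
      "\<And>xs. xs \<in> seqs (Suc N) \<Longrightarrow> \<phi>X xs \<in> {1..msgs (Suc N) RX}"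
      "err_prob p f (Suc N) \<phi>0 \<phi>X \<phi>Y \<psi> \<le> \<epsilon>"
      unfolding good_code_def by blast
    then show ?thesis by (intro code.converse_block[OF _ c _ _ _ \<theta>]) auto
  qed
  have le': "cond_graph_entropy p f \<le> R0 + RX + (- log 2 (1 - \<theta>))" if \<theta>: "0 < \<theta>" "\<theta> < 1" for \<theta> :: real
  proof (rule tendsto_lowerbound)
    show "((\<lambda>\<epsilon>. R0 + RX + (- log 2 (1 - \<theta>) + real CARD('y) / c * \<epsilon> * log 2 (CARD('x set) / \<theta>)))
       \<longlongrightarrow> R0 + RX + (- log 2 (1 - \<theta>))) (at_right 0)"
      using c(1) by (auto intro!: tendsto_eq_intros)
    show "\<forall>\<^sub>F \<epsilon> in at_right 0. cond_graph_entropy p f \<le> R0 + RX + (- log 2 (1 - \<theta>) + real CARD('y) / c * \<epsilon> * log 2 (CARD('x set) / \<theta>))"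
      using le \<theta> by (auto simp: eventually_at_right_field intro: exI[of _ 1])
  qed simp
  show ?thesis
  proof (rule tendsto_lowerbound)
    show "((\<lambda>\<theta>. R0 + RX + (- log 2 (1 - \<theta>))) \<longlongrightarrow> R0 + RX) (at_right 0)"
      by (auto intro!: tendsto_eq_intros)
    show "\<forall>\<^sub>F \<theta> in at_right 0. cond_graph_entropy p f \<le> R0 + RX + (- log 2 (1 - \<theta>))"
      using le' by (auto simp: eventually_at_right_field intro: exI[of _ 1])
  qed simp
qed

text \<open>For a negative rate and positive block length the floor in \<open>msgs\<close> is 0,
  which leaves an encoder no message. The error level 1 is arbitrary, since only the existence of a
  code matters.\<close>

lemma achievable_imp_nonneg:
  fixes p :: "('x::finite \<times> 'y::finite) pmf" and f :: "'x \<Rightarrow> 'y \<Rightarrow> 'f"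
  assumes "achievable p f (R0, RX, RY)"
  shows "R0 \<ge> 0 \<and> RX \<ge> 0 \<and> RY \<ge> 0"
proof -
  obtain N where N: "\<And>n. n \<ge> N \<Longrightarrow> good_code p f n R0 RX RY 1"
    using assms unfolding achievable_def prod.case by (meson zero_less_one)
  define n where "n = Suc N"
  have "good_code p f n R0 RX RY 1" unfolding n_def by (rule N) simp
  moreover have "restrict undefined {..<n} \<in> (seqs n :: (nat \<Rightarrow> 'x) set)"
    "restrict undefined {..<n} \<in> (seqs n :: (nat \<Rightarrow> 'y) set)" by (auto simp: seqs_def)
  ultimately have "msgs n R0 > 0" "msgs n RX > 0" "msgs n RY > 0"
    unfolding good_code_def by fastforce+
  moreover have "R \<ge> 0" if "msgs n R > 0" for R
  proof (rule ccontr)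
    assume "\<not> R \<ge> 0"
    then have "2 powr (real n * R) < 1" by (intro powr_less_one) (auto simp: n_def mult_less_0_iff)
    then have "msgs n R = 0" unfolding msgs_def by (simp add: floor_less_iff)
    then show False using that by simp
  qed
  ultimately show ?thesis by blast
qed

text \<open>The choice V = {X} works because no vertex is adjacent to itself. It makes the set under
  the infimum nonempty.\<close>

lemma exists_admissible_V: "\<exists>Q. admissible_V p f Q"
  by (rule exI[of _ "\<lambda>x. return_pmf {x}"])
     (auto simp: admissible_V_def indep_set_def char_adj_def indicator_def split: if_splits)

theorem theorem4:
  fixes p :: "('x::finite \<times> 'y::finite) pmf" and f :: "'x \<Rightarrow> 'y \<Rightarrow> 'f"
  shows "{(R0, RX, RY) \<in> rate_region p f. RY > R0 + entropy_pmf (map_pmf snd p)} =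
         {(R0, RX, RY). R0 \<ge> 0 \<and> RX \<ge> 0 \<and> RY \<ge> 0 \<and>
            RY > R0 + entropy_pmf (map_pmf snd p) \<and>
            R0 + RX \<ge> cond_graph_entropy p f}"
proof -
  \<comment> \<open>A closed set containing all achievable triples, hence the whole rate
    region.\<close>
  define K where "K = {r :: real \<times> real \<times> real. fst r \<ge> 0 \<and> fst (snd r) \<ge> 0 \<and> snd (snd r) \<ge> 0
     \<and> fst r + fst (snd r) \<ge> cond_graph_entropy p f}"
  have "closed K"
    unfolding K_def by (intro closed_Collect_conj closed_Collect_le continuous_intros)
  moreover have "{r. achievable p f r} \<subseteq> K"
  proof
    fix r assume "r \<in> {r. achievable p f r}"
    moreover obtain R0 RX RY where "r = (R0, RX, RY)" by (cases r)
    ultimately show "r \<in> K"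
      using achievable_imp_nonneg[of p f R0 RX RY] achievable_imp_cond_graph_entropy_le[of p f R0 RX RY]
      by (simp add: K_def)
  qed
  ultimately have converse: "rate_region p f \<subseteq> K"
    unfolding rate_region_def by (rule closure_minimal[rotated])
  have direct: "(R0, RX, RY) \<in> rate_region p f"
    if R: "R0 \<ge> 0" "RX \<ge> 0" and RY: "RY > R0 + entropy_pmf (map_pmf snd p)"
      and H: "R0 + RX \<ge> cond_graph_entropy p f" for R0 RX RY
  proof -
    \<comment> \<open>Raising \<open>RX\<close> slightly makes the inequality strict, so that some
      admissible V lies below the total rate. The boundary is reached in the closure.\<close>
    have ach: "achievable p f (R0, RX + inverse (real (Suc k)), RY)" for k
    proof -
      have "Inf {cond_mutual_info p Q | Q. admissible_V p f Q} < R0 + (RX + inverse (real (Suc k)))"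
        using H unfolding cond_graph_entropy_def by (smt (verit) inverse_positive_iff_positive of_nat_0_less_iff zero_less_Suc)
      then obtain Q where "admissible_V p f Q" "cond_mutual_info p Q < R0 + (RX + inverse (real (Suc k)))"
        using exists_admissible_V[of p f] by (subst (asm) cInf_less_iff[OF _ bdd_below_cond_mutual_info]) auto
      then show ?thesis
        using R RY by (intro achievable_above_cond_mutual_info) auto
    qed
    have "(\<lambda>k. (R0, RX + inverse (real (Suc k)), RY)) \<longlonglongrightarrow> (R0, RX + 0, RY)"
      by (intro tendsto_intros LIMSEQ_inverse_real_of_nat)
    then show ?thesis
      unfolding rate_region_def closure_sequential using ach by force
  qed
  show ?thesis
  proof (intro set_eqI iffI)
    fix r assume "r \<in> {(R0, RX, RY) \<in> rate_region p f. RY > R0 + entropy_pmf (map_pmf snd p)}"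
    then show "r \<in> {(R0, RX, RY). R0 \<ge> 0 \<and> RX \<ge> 0 \<and> RY \<ge> 0 \<and>
            RY > R0 + entropy_pmf (map_pmf snd p) \<and> R0 + RX \<ge> cond_graph_entropy p f}"
      using converse by (auto simp: K_def)
  next
    fix r assume "r \<in> {(R0, RX, RY). R0 \<ge> 0 \<and> RX \<ge> 0 \<and> RY \<ge> 0 \<and>
            RY > R0 + entropy_pmf (map_pmf snd p) \<and> R0 + RX \<ge> cond_graph_entropy p f}"
    then show "r \<in> {(R0, RX, RY) \<in> rate_region p f. RY > R0 + entropy_pmf (map_pmf snd p)}"
      using direct by auto
  qed
qed

end
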